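(* Let $\mathcal{F}:\mathcal{M}(\mathcal{X}\times\mathcal{Y})\to\mathbb{R}\cup\{+\infty\}$ be convex, lower semi-continuous and separably $*$-increasing, and assume there exists $\pi\in\Pi(\mathbb{P},\mathbb{Q})$ with $\mathcal{F}(\pi)<\infty$. Then $$\mathrm{Cost}(\mathbb{P},\mathbb{Q})=\sup_{v\in\mathcal{C}(\mathcal{Y})}\ \inf_{\pi\in\Pi(\mathbb{P})}\mathcal{L}(v,\pi)=\sup_{v\in\mathcal{C}(\mathcal{Y})}\ \inf_{\pi\in\Pi(\mathbb{P})}\left\{\Big[\mathcal{F}(\pi)-\int_{\mathcal{Y}}v(y)\,d\pi(y)\Big]+\int_{\mathcal{Y}}v(y)\,d\mathbb{Q}(y)\right\},$$ where $\pi(y)$ denotes the marginal of $\pi$ on $\mathcal{Y}$.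
   Context: Let $D\ge 1$ and let $\mathcal{X}=\mathcal{Y}\subset\mathbb{R}^D$ be compact; $\mathbb{P}\in\mathcal{P}(\mathcal{X})$, $\mathbb{Q}\in\mathcal{P}(\mathcal{Y})$. For a compact Hausdorff space $\mathcal{S}$, $\mathcal{C}(\mathcal{S})$ is the space of continuous real functions with the sup norm, $\mathcal{M}(\mathcal{S})$ its dual (finite signed Borel measures), and $\mathcal{P}(\mathcal{S})\subset\mathcal{M}(\mathcal{S})$ the Borel probability measures; lower semi-continuity is with respect to the weak-$*$ topology. $\Pi(\mathbb{P})$ is the set of probability measures on $\mathcal{X}\times\mathcal{Y}$ whose first marginal is $\mathbb{P}$, and $\Pi(\mathbb{P},\mathbb{Q})\subset\Pi(\mathbb{P})$ those with marginals $\mathbb{P},\mathbb{Q}$. For $\mathcal{F}:\mathcal{M}(\mathcal{X}\times\mathcal{Y})\to\mathbb{R}\cup\{+\infty\}$ its convex conjugate is $\mathcal{F}^*(h)=\sup_{\pi\in\mathcal{M}(\mathcal{X}\times\mathcal{Y})}\big[\int h\,d\pi-\mathcal{F}(\pi)\big]$ for $h\in\mathcal{C}(\mathcal{X}\times\mathcal{Y})$. For $u\in\mathcal{C}(\mathcal{X}),v\in\mathcal{C}(\mathcal{Y})$, $(u\oplus v)(x,y)=u(x)+v(y)$. $\mathcal{F}$ is separably $*$-increasing if for all $u\in\mathcal{C}(\mathcal{X})$, $v\in\mathcal{C}(\mathcal{Y})$, $c\in\mathcal{C}(\mathcal{X}\times\mathcal{Y})$ with $u\oplus v\le c$ pointwise,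 $\mathcal{F}^*(u\oplus v)\le\mathcal{F}^*(c)$. The general OT cost is $\mathrm{Cost}(\mathbb{P},\mathbb{Q})=\inf_{\pi\in\Pi(\mathbb{P},\mathbb{Q})}\mathcal{F}(\pi)$. For $v\in\mathcal{C}(\mathcal{Y})$ and $\pi\in\Pi(\mathbb{P})$, $\mathcal{L}(v,\pi)=\mathcal{F}(\pi)-\int_{\mathcal{Y}}v\,d\pi_{\mathcal{Y}}+\int_{\mathcal{Y}}v\,d\mathbb{Q}$, where $\pi_{\mathcal{Y}}$ is the second marginal of $\pi$. *)

theory Defs
  imports "HOL-Probability.Probability"
begin

definition Bor :: "'a::topological_space set \<Rightarrow> 'a set set" where
  "Bor S = sets (restrict_space borel S)"

text \<open>M(S): finite signed Borel measures on S, as real-valued countably additive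
  set functions on the Borel sets of S (normalised to 0 outside them).\<close>
definition fsm :: "'a::topological_space set \<Rightarrow> ('a set \<Rightarrow> real) set" where
  "fsm S = {\<sigma>. (\<forall>A. A \<notin> Bor S \<longrightarrow> \<sigma> A = 0) \<and> \<sigma> {} = 0 \<and>
      (\<forall>A::nat \<Rightarrow> 'a set. range A \<subseteq> Bor S \<longrightarrow> disjoint_family A \<longrightarrow>
          (\<lambda>n. \<sigma> (A n)) sums \<sigma> (\<Union>n. A n))}"

definition jordan_pos :: "'a::topological_space set \<Rightarrow> ('a set \<Rightarrow> real) \<Rightarrow> 'a measure" where
  "jordan_pos S \<sigma> = measure_of S (Bor S)
      (\<lambda>A. ennreal (Sup {\<sigma> B | B. B \<in> Bor S \<and> B \<subseteq> A}))"

definition sint :: "'a::topological_space set \<Rightarrow> ('a set \<Rightarrow> real) \<Rightarrow> ('a \<Rightarrow> real) \<Rightarrow> real" where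
  "sint S \<sigma> h = integral\<^sup>L (jordan_pos S \<sigma>) h - integral\<^sup>L (jordan_pos S (\<lambda>A. - \<sigma> A)) h"

definition Cf :: "'a::topological_space set \<Rightarrow> ('a \<Rightarrow> real) set" where
  "Cf S = {h. continuous_on S h}"

definition prob_measures :: "'a::topological_space set \<Rightarrow> ('a set \<Rightarrow> real) set" where
  "prob_measures S = {\<sigma> \<in> fsm S. (\<forall>A. 0 \<le> \<sigma> A) \<and> \<sigma> S = 1}"

definition marg2 :: "'a::topological_space set \<Rightarrow> 'b::topological_space set \<Rightarrow>
    (('a \<times> 'b) set \<Rightarrow> real) \<Rightarrow> ('b set \<Rightarrow> real)" where
  "marg2 X Y \<pi> = (\<lambda>A. if A \<in> Bor Y then \<pi> (X \<times> A) else 0)"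

definition Pi1 :: "'a::topological_space set \<Rightarrow> 'b::topological_space set \<Rightarrow> 'a measure \<Rightarrow>
    (('a \<times> 'b) set \<Rightarrow> real) set" where
  "Pi1 X Y P = {\<pi> \<in> prob_measures (X \<times> Y). \<forall>A \<in> Bor X. \<pi> (A \<times> Y) = measure P A}"

definition Pi2 :: "'a::topological_space set \<Rightarrow> 'b::topological_space set \<Rightarrow> 'a measure \<Rightarrow>
    'b measure \<Rightarrow> (('a \<times> 'b) set \<Rightarrow> real) set" where
  "Pi2 X Y P Q = {\<pi> \<in> Pi1 X Y P. \<forall>A \<in> Bor Y. \<pi> (X \<times> A) = measure Q A}"

definition wstar :: "'a::topological_space set \<Rightarrow> ('a set \<Rightarrow> real) topology" where
  "wstar S = topology_generated_by
      {{\<pi> \<in> fsm S. sint S \<pi> h \<in> U} | h U. continuous_on S h \<and> open (U::real set)}"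

definition wstar_lsc :: "'a::topological_space set \<Rightarrow> (('a set \<Rightarrow> real) \<Rightarrow> ereal) \<Rightarrow> bool" where
  "wstar_lsc S F \<longleftrightarrow> (\<forall>t::real. closedin (wstar S) {\<pi> \<in> fsm S. F \<pi> \<le> ereal t})"

definition convex_M :: "'a::topological_space set \<Rightarrow> (('a set \<Rightarrow> real) \<Rightarrow> ereal) \<Rightarrow> bool" where
  "convex_M S F \<longleftrightarrow> (\<forall>\<sigma>1 \<in> fsm S. \<forall>\<sigma>2 \<in> fsm S. \<forall>t::real. 0 \<le> t \<and> t \<le> 1 \<longrightarrow>
      F (\<lambda>A. t * \<sigma>1 A + (1 - t) * \<sigma>2 A) \<le> ereal t * F \<sigma>1 + ereal (1 - t) * F \<sigma>2)"

definition conj :: "'a::topological_space set \<Rightarrow> (('a set \<Rightarrow> real) \<Rightarrow> ereal) \<Rightarrow> ('a \<Rightarrow> real) \<Rightarrow> ereal" where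
  "conj S F h = (SUP \<pi> \<in> fsm S. ereal (sint S \<pi> h) - F \<pi>)"

definition oplus :: "('a \<Rightarrow> real) \<Rightarrow> ('b \<Rightarrow> real) \<Rightarrow> ('a \<times> 'b \<Rightarrow> real)" where
  "oplus u v = (\<lambda>(x, y). u x + v y)"

definition sep_star_incr :: "'a::topological_space set \<Rightarrow> 'b::topological_space set \<Rightarrow>
    ((('a \<times> 'b) set \<Rightarrow> real) \<Rightarrow> ereal) \<Rightarrow> bool" where
  "sep_star_incr X Y F \<longleftrightarrow> (\<forall>u v c. continuous_on X u \<longrightarrow> continuous_on Y v \<longrightarrow>
      continuous_on (X \<times> Y) c \<longrightarrow> (\<forall>x \<in> X. \<forall>y \<in> Y. u x + v y \<le> c (x, y)) \<longrightarrow>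
      conj (X \<times> Y) F (oplus u v) \<le> conj (X \<times> Y) F c)"

definition Cost :: "'a::topological_space set \<Rightarrow> 'b::topological_space set \<Rightarrow>
    ((('a \<times> 'b) set \<Rightarrow> real) \<Rightarrow> ereal) \<Rightarrow> 'a measure \<Rightarrow> 'b measure \<Rightarrow> ereal" where
  "Cost X Y F P Q = (INF \<pi> \<in> Pi2 X Y P Q. F \<pi>)"

definition Lag :: "'a::topological_space set \<Rightarrow> 'b::topological_space set \<Rightarrow>
    ((('a \<times> 'b) set \<Rightarrow> real) \<Rightarrow> ereal) \<Rightarrow> 'b measure \<Rightarrow> ('b \<Rightarrow> real) \<Rightarrow>
    (('a \<times> 'b) set \<Rightarrow> real) \<Rightarrow> ereal" where
  "Lag X Y F Q v \<pi> = F \<pi> - ereal (sint Y (marg2 X Y \<pi>) v) + ereal (integral\<^sup>L Q v)"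

end

theory Submission
  imports Defs
begin

text \<open>The inequality from right to left holds because the Lagrangian equals the objective on plans
  with second marginal Q. For the converse, the plans with first marginal P form a weak-*
  sequentially compact convex set, on which the Lagrangian is convex and lower semicontinuous in
  the plan and affine in the potential. Below any level t smaller than the cost, compactness yields
  finitely many potentials whose maximal Lagrangian is at least t on all plans, and a finite
  minimax theorem replaces them by one convex combination.

  Weak-* compactness is reduced to Helly's selection theorem on the real line: every compact K in a
  Euclidean space is the image of a compact set C of reals under a continuous map with a Borel
  right inverse, so that probability measures on K can be pushed to C and back.\<close>

section \<open>Signed-measure encoding of probability measures\<close>

text \<open>Closedness of the sublevel sets of \<open>F\<close> is exploited only along sequences,
  so the constraint that the second marginal be \<open>Q\<close> has to be tested by countably many
  functions. A fixed measure-determining sequence \<open>V k\<close> does this, and the potentials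
  \<open>n * V k\<close> and \<open>- n * V k\<close> with \<open>k \<le> n\<close> act as
  penalties: a plan whose Lagrangian stays below \<open>t\<close> for all of them misses each tested
  equation by at most \<open>(t - b) / n\<close>, where \<open>b\<close> bounds \<open>F\<close>
  from below on \<open>Pi1\<close>. One extracted limit thus replaces a finite subcover.

  The obstacle in the transfer to the line is that the Borel right inverse need not be continuous,
  so weak convergence cannot be carried through it for arbitrary test functions.

  The value \<open>\<infinity>\<close> of \<open>F\<close> is kept out of the minimax argument by
  restricting it to plans of finite cost, which again form a convex set; all other plans satisfy the
  required inequality trivially.\<close>

text \<open>Bridge from real-valued set functions to library measures, so that integration theory
  applies. On probability measures it is inverse to \<open>measure\<close>.\<close>

definition to_measure :: "'a::topological_space set \<Rightarrow> ('a set \<Rightarrow> real) \<Rightarrow> 'a measure" where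
  "to_measure S \<sigma> = measure_of S (Bor S) (\<lambda>A. ennreal (\<sigma> A))"

lemma Bor_subset_Pow: "Bor S \<subseteq> Pow S"
  unfolding Bor_def using sets.space_closed[of "restrict_space borel S"]
  by (simp add: space_restrict_space)

lemma sigma_sets_Bor: "sigma_sets S (Bor S) = Bor S"
  unfolding Bor_def using sets.sigma_sets_eq[of "restrict_space borel S"]
  by (simp add: space_restrict_space)

lemma Bor_empty: "{} \<in> Bor S" and Bor_whole: "S \<in> Bor S"
  unfolding Bor_def using sets.top[of "restrict_space borel S"]
  by (simp_all add: space_restrict_space)

lemma sets_to_measure [measurable_cong]:
    "sets (to_measure S \<sigma>) = sets (restrict_space borel S)"
  and space_to_measure [simp]: "space (to_measure S \<sigma>) = S"
  unfolding to_measure_def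
  by (simp_all add: sets_measure_of space_measure_of Bor_subset_Pow sigma_sets_Bor)
     (simp add: Bor_def)

lemma emeasure_to_measure:
  assumes "\<sigma> \<in> prob_measures S" "A \<in> Bor S"
  shows "emeasure (to_measure S \<sigma>) A = ennreal (\<sigma> A)"
  unfolding to_measure_def
proof (rule emeasure_measure_of_sigma)
  have nn: "\<And>A. 0 \<le> \<sigma> A" and e: "\<sigma> {} = 0"
    using assms(1) by (auto simp: prob_measures_def fsm_def)
  show "sigma_algebra S (Bor S)"
    using sets.sigma_algebra_axioms[of "restrict_space borel S"]
    by (simp add: space_restrict_space Bor_def)
  show "positive (Bor S) (\<lambda>A. ennreal (\<sigma> A))"
    by (simp add: positive_def e)
  show "countably_additive (Bor S) (\<lambda>A. ennreal (\<sigma> A))"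
    unfolding countably_additive_def
  proof (intro allI impI)
    fix A :: "nat \<Rightarrow> 'a set"
    assume "range A \<subseteq> Bor S" "disjoint_family A"
    then have "(\<lambda>n. \<sigma> (A n)) sums \<sigma> (\<Union>n. A n)"
      using assms(1) by (auto simp: prob_measures_def fsm_def)
    then have "(\<lambda>n. ennreal (\<sigma> (A n))) sums ennreal (\<sigma> (\<Union>n. A n))"
      using nn by simp
    then show "(\<Sum>n. ennreal (\<sigma> (A n))) = ennreal (\<sigma> (\<Union>(range A)))"
      by (rule sums_unique[symmetric])
  qed
  show "A \<in> Bor S" by fact
qed

text \<open>The equality is one of total functions: off \<open>Bor S\<close> both sides are 0, on
  the left by the convention for \<open>measure\<close>, on the right by the normalisation in
  \<open>fsm\<close>.\<close>

lemma measure_to_measure: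
  assumes "\<sigma> \<in> prob_measures S"
  shows "measure (to_measure S \<sigma>) = \<sigma>"
proof
  fix A
  show "measure (to_measure S \<sigma>) A = \<sigma> A"
  proof (cases "A \<in> Bor S")
    case True
    then show ?thesis
      using emeasure_to_measure[OF assms True] assms
      by (auto simp: measure_def prob_measures_def)
  next
    case False
    then have "\<sigma> A = 0" using assms by (auto simp: prob_measures_def fsm_def)
    moreover have "measure (to_measure S \<sigma>) A = 0"
      using False by (intro measure_notin_sets) (simp add: sets_to_measure Bor_def)
    ultimately show ?thesis by simp
  qed
qed

lemma prob_space_to_measure:
  assumes "\<sigma> \<in> prob_measures S"
  shows "prob_space (to_measure S \<sigma>)"
  using emeasure_to_measure[OF assms Bor_whole] assms
  by (intro prob_spaceI) (simp add: prob_measures_def)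

lemma measure_in_prob_measures:
  assumes "prob_space M" "sets M = sets (restrict_space borel S)"
  shows "measure M \<in> prob_measures S"
proof -
  interpret prob_space M by fact
  have "space M = S"
    using sets_eq_imp_space_eq[OF assms(2)] by (simp add: space_restrict_space)
  then show ?thesis
    unfolding prob_measures_def fsm_def Bor_def assms(2)[symmetric]
    by (auto simp: measure_notin_sets prob_space intro!: finite_measure_UNION)
qed

lemma to_measure_measure:
  assumes "prob_space M" "sets M = sets (restrict_space borel S)"
  shows "to_measure S (measure M) = M"
proof (rule measure_eqI)
  interpret prob_space M by fact
  show "sets (to_measure S (measure M)) = sets M"
    by (simp add: sets_to_measure assms)
  fix A assume "A \<in> sets (to_measure S (measure M))"
  then show "emeasure (to_measure S (measure M)) A = emeasure M A"
    by (subst emeasure_to_measure[OF measure_in_prob_measures[OF assms]])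
       (auto simp: sets_to_measure Bor_def emeasure_eq_measure)
qed

text \<open>For a nonnegative set function the supremum defining the positive part is attained at
  the set itself, and the one for the negated function at the empty set. The negative part is
  therefore the null measure.\<close>

lemma sint_prob:
  assumes "\<sigma> \<in> prob_measures S"
  shows "sint S \<sigma> h = (\<integral>x. h x \<partial>to_measure S \<sigma>)"
proof -
  interpret prob_space "to_measure S \<sigma>" by (rule prob_space_to_measure[OF assms])
  have nn: "\<And>A. 0 \<le> \<sigma> A" and e: "\<sigma> {} = 0"
    using assms by (auto simp: prob_measures_def fsm_def)
  have mono: "\<sigma> B \<le> \<sigma> A" if "A \<in> Bor S" "B \<subseteq> A" for A B
    using finite_measure_mono[OF that(2)] that(1)
    by (simp add: measure_to_measure[OF assms] sets_to_measure Bor_def)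
  have 1: "jordan_pos S \<sigma> = to_measure S \<sigma>"
    unfolding jordan_pos_def to_measure_def
  proof (rule measure_of_eq[OF Bor_subset_Pow])
    fix A assume "A \<in> sigma_sets S (Bor S)"
    then have A: "A \<in> Bor S" by (simp add: sigma_sets_Bor)
    have "Sup {\<sigma> B |B. B \<in> Bor S \<and> B \<subseteq> A} = \<sigma> A"
      by (rule cSup_eq_maximum) (use A mono in auto)
    then show "ennreal (Sup {\<sigma> B |B. B \<in> Bor S \<and> B \<subseteq> A}) = ennreal (\<sigma> A)" by simp
  qed
  have 2: "jordan_pos S (\<lambda>A. - \<sigma> A) = null_measure (restrict_space borel S)"
  proof (rule measure_eqI)
    show "sets (jordan_pos S (\<lambda>A. - \<sigma> A)) = sets (null_measure (restrict_space borel S))"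
      unfolding jordan_pos_def
      by (simp add: sets_measure_of Bor_subset_Pow sigma_sets_Bor) (simp add: Bor_def)
    fix A
    have "jordan_pos S (\<lambda>A. - \<sigma> A) = measure_of S (Bor S) (\<lambda>_. 0)"
      unfolding jordan_pos_def
    proof (rule measure_of_eq[OF Bor_subset_Pow])
      fix A
      have "Sup {- \<sigma> B |B. B \<in> Bor S \<and> B \<subseteq> A} = 0"
        by (rule cSup_eq_maximum) (use Bor_empty nn e in \<open>auto intro!: exI[of _ "{}"]\<close>)
      then show "ennreal (Sup {- \<sigma> B |B. B \<in> Bor S \<and> B \<subseteq> A}) = 0" by simp
    qed
    then show "emeasure (jordan_pos S (\<lambda>A. - \<sigma> A)) A
        = emeasure (null_measure (restrict_space borel S)) A"
      by (simp add: emeasure_sigma)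
  qed
  have "(\<integral>x. h x \<partial>null_measure (restrict_space borel S)) = 0"
    by (intro integral_eq_zero_AE AE_I'[of "space (restrict_space borel S)"])
       (auto simp: null_sets_def)
  then show ?thesis unfolding sint_def 1 2 by simp
qed

section \<open>Compact sets as continuous images of compact sets of reals\<close>

text \<open>Each partial sum depends on finitely many coordinates, and the convergence is uniform by
  comparison with a geometric series. The reindexing \<open>r\<close> allows several numbers to be
  read from disjoint subsequences of one digit sequence.\<close>

lemma continuous_on_digit_sum:
  fixes b :: real and r :: "nat \<Rightarrow> nat"
  assumes "1 < b"
  shows "continuous_on (PiE UNIV (\<lambda>_. {0,1})) (\<lambda>s. \<Sum>n. s (r n) / b ^ n)"
proof (rule uniform_limit_theorem)
  show "uniform_limit (PiE UNIV (\<lambda>_. {0,1})) (\<lambda>N s. \<Sum>n<N. s (r n) / b ^ n)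
      (\<lambda>s. \<Sum>n. s (r n) / b ^ n) sequentially"
  proof (rule Weierstrass_m_test)
    show "norm (s (r n) / b ^ n) \<le> (1 / b) ^ n"
      if "s \<in> PiE UNIV (\<lambda>_. {0,1})" for n and s :: "nat \<Rightarrow> real"
    proof -
      have "s (r n) \<in> {0,1}" using that by auto
      then show ?thesis using assms by (auto simp: power_divide)
    qed
    show "summable (\<lambda>n. (1 / b) ^ n)" using assms by (intro summable_geometric) simp
  qed
  show "\<forall>\<^sub>F N in sequentially. continuous_on (PiE UNIV (\<lambda>_. {0,1})) (\<lambda>s. \<Sum>n<N. s (r n) / b ^ n)"
    using assms
    by (intro always_eventually allI continuous_intros continuous_on_product_coordinates
        continuous_on_subset[OF continuous_on_product_coordinates subset_UNIV]) auto
qed simp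

lemma summable_digits:
  fixes b :: real
  assumes "1 < b" "\<And>n. s n \<in> {0,1}"
  shows "summable (\<lambda>n. s n / b ^ n)"
proof (rule summable_comparison_test')
  show "summable (\<lambda>n. (1 / b) ^ n)" using assms by (intro summable_geometric) simp
  show "norm (s n / b ^ n) \<le> (1 / b) ^ n" if "0 \<le> n" for n
    using assms(1) assms(2)[of n] by (auto simp: power_divide)
qed

text \<open>The bound 3/2 is the geometric series of ratio 1/3. After division by 3 the tail
  contributes at most 1/2, less than the gap 1 between the two possible leading digits; in base 2
  the tail could fill that gap.\<close>

lemma ternary_sum_Suc:
  fixes s :: "nat \<Rightarrow> real"
  assumes s: "\<And>n. s n \<in> {0,1}"
  shows "(\<Sum>n. s n / 3 ^ n) = s 0 + (\<Sum>n. s (Suc n) / 3 ^ n) / 3"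
    and "0 \<le> (\<Sum>n. s (Suc n) / 3 ^ n)" and "(\<Sum>n. s (Suc n) / 3 ^ n) \<le> 3/2"
proof -
  have sm: "summable (\<lambda>n. s (Suc n) / 3 ^ n)" by (rule summable_digits) (use s in auto)
  have "(\<Sum>n. s (Suc n) / 3 ^ Suc n) = (\<Sum>n. s (Suc n) / 3 ^ n / 3)"
    by (simp add: mult.commute)
  also have "\<dots> = (\<Sum>n. s (Suc n) / 3 ^ n) / 3" by (rule suminf_divide[OF sm])
  finally show "(\<Sum>n. s n / 3 ^ n) = s 0 + (\<Sum>n. s (Suc n) / 3 ^ n) / 3"
    using suminf_split_head[OF summable_digits[of 3 s]] s by simp
  have le: "s k \<le> 1" "0 \<le> s k" for k using s[of k] by auto
  show "0 \<le> (\<Sum>n. s (Suc n) / 3 ^ n)" by (intro suminf_nonneg[OF sm]) (simp add: le)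
  have "(\<Sum>n. s (Suc n) / 3 ^ n) \<le> (\<Sum>n. (1/3) ^ n)"
    by (intro suminf_le sm summable_geometric) (auto simp: le power_divide divide_right_mono)
  also have "\<dots> = 3/2" by (subst suminf_geometric) auto
  finally show "(\<Sum>n. s (Suc n) / 3 ^ n) \<le> 3/2" .
qed

text \<open>By the tail bounds, equal sums force equal leading digits and then equal tails, so the
  induction passes to the shifted sequences.\<close>

lemma ternary_sum_inj:
  fixes s t :: "nat \<Rightarrow> real"
  assumes "\<And>n. s n \<in> {0,1}" "\<And>n. t n \<in> {0,1}"
    and "(\<Sum>n. s n / 3 ^ n) = (\<Sum>n. t n / 3 ^ n)"
  shows "s n = t n"
proof -
  have head: "s 0 = t 0 \<and> (\<Sum>n. s (Suc n) / 3 ^ n) = (\<Sum>n. t (Suc n) / 3 ^ n)"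
    if st: "\<And>n. s n \<in> {0,1}" "\<And>n. t n \<in> {0,1}" "(\<Sum>n. s n / 3 ^ n) = (\<Sum>n. t n / 3 ^ n)"
    for s t :: "nat \<Rightarrow> real"
  proof -
    have "s 0 + (\<Sum>n. s (Suc n) / 3 ^ n) / 3 = t 0 + (\<Sum>n. t (Suc n) / 3 ^ n) / 3"
      using st(3) ternary_sum_Suc(1)[of s, OF st(1)] ternary_sum_Suc(1)[of t, OF st(2)] by simp
    then show ?thesis
      using ternary_sum_Suc(2,3)[of s, OF st(1)] ternary_sum_Suc(2,3)[of t, OF st(2)]
        st(1)[of 0] st(2)[of 0]
      by auto
  qed
  show ?thesis
    using assms
  proof (induction n arbitrary: s t)
    case 0
    then show ?case using head by blast
  next
    case (Suc n s t)
    have "s (Suc n) = t (Suc n)"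
      by (rule Suc.IH[of "\<lambda>n. s (Suc n)" "\<lambda>n. t (Suc n)"])
         (use Suc.prems head[of s t] in blast)+
    then show ?case .
  qed
qed

text \<open>Half of \<open>d n / 2 ^ n\<close> is the increment of \<open>q n / 2 ^ n\<close>, so
  the series telescopes from \<open>q 0 = 0\<close> to the limit \<open>x\<close>. The weights start
  at 1 instead of 1/2, hence the value \<open>2 * x\<close>.\<close>

lemma binary_expansion:
  fixes x :: real
  assumes "0 \<le> x" "x < 1"
  obtains d :: "nat \<Rightarrow> real" where "\<And>n. d n \<in> {0,1}" "(\<Sum>n. d n / 2 ^ n) = 2 * x"
proof
  define q where "q n = \<lfloor>2 ^ n * x\<rfloor>" for n :: nat
  define d where "d n = real_of_int (q (Suc n) - 2 * q n)" for n
  show "d n \<in> {0,1}" for n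
  proof -
    have "2 * q n \<le> q (Suc n)" "q (Suc n) \<le> 2 * q n + 1"
      unfolding q_def by (simp_all add: le_floor_iff floor_le_iff) linarith+
    then have "q (Suc n) - 2 * q n = 0 \<or> q (Suc n) - 2 * q n = 1" by linarith
    then show ?thesis unfolding d_def by auto
  qed
  have lim: "(\<lambda>n. real_of_int (q n) / 2 ^ n) \<longlonglongrightarrow> x"
  proof (rule tendsto_sandwich)
    have q: "q n \<le> 2 ^ n * x" "2 ^ n * x - 1 \<le> q n" for n
      unfolding q_def by linarith+
    have "x - (1/2) ^ n = (2 ^ n * x - 1) / 2 ^ n" for n
      by (simp add: diff_divide_distrib power_divide)
    then have "x - (1/2) ^ n \<le> real_of_int (q n) / 2 ^ n" for n
      using divide_right_mono[OF q(2)[of n], of "2 ^ n"] by simp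
    moreover have "real_of_int (q n) / 2 ^ n \<le> x" for n
      using q(1)[of n] by (simp add: field_simps)
    ultimately show "\<forall>\<^sub>F n in sequentially. x - (1/2) ^ n \<le> real_of_int (q n) / 2 ^ n"
      "\<forall>\<^sub>F n in sequentially. real_of_int (q n) / 2 ^ n \<le> x"
      by simp_all
    show "(\<lambda>n. x - (1/2) ^ n) \<longlonglongrightarrow> x"
      by (auto intro!: tendsto_eq_intros LIMSEQ_realpow_zero)
  qed simp
  have "(\<lambda>n. real_of_int (q (Suc n)) / 2 ^ Suc n - real_of_int (q n) / 2 ^ n) sums (x - real_of_int (q 0) / 2 ^ 0)"
    by (rule telescope_sums[OF lim])
  moreover have "q 0 = 0" using assms by (simp add: q_def floor_eq_iff)
  moreover have "real_of_int (q (Suc n)) / 2 ^ Suc n - real_of_int (q n) / 2 ^ n = d n / 2 ^ n / 2" for n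
    by (simp add: d_def field_simps)
  ultimately have "(\<lambda>n. d n / 2 ^ n / 2) sums x" by simp
  then have "(\<lambda>n. 2 * (d n / 2 ^ n / 2)) sums (2 * x)" by (rule sums_mult)
  then show "(\<Sum>n. d n / 2 ^ n) = 2 * x" by (simp add: sums_iff)
qed

text \<open>A form of the Hausdorff-Alexandroff theorem. The Cantor set is mapped continuously into
  a cube so that \<open>K\<close> is covered; the preimage of \<open>K\<close> is closed in a
  compact set, and it is taken as \<open>C\<close>.\<close>

lemma compact_continuous_image_of_real_compact:
  fixes K :: "'b::euclidean_space set"
  assumes "compact K"
  obtains C :: "real set" and \<phi> where "compact C" "continuous_on C \<phi>" "\<phi> ` C = K"
proof -
  define D where "D = PiE (UNIV :: nat set) (\<lambda>_. {0, 1 :: real})"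
  have D: "s \<in> D \<longleftrightarrow> (\<forall>n. s n \<in> {0,1})" for s unfolding D_def by auto
  have "compactin (product_topology (\<lambda>_. euclidean) UNIV) D"
    unfolding D_def by (subst compactin_PiE) auto
  then have cD: "compact D" by (simp add: euclidean_product_topology)
  \<comment> \<open>Digits 0 and 1 in base 3 embed the Cantor space D into the line; the map g reads a point of
    a cube from interleaved binary digits.\<close>
  define e where "e s = (\<Sum>n. s n / 3 ^ n)" for s :: "nat \<Rightarrow> real"
  have ce: "continuous_on D e"
    unfolding D_def e_def using continuous_on_digit_sum[of 3 "\<lambda>n. n"] by simp
  have inj: "inj_on e D"
  proof (rule inj_onI)
    fix s t assume "s \<in> D" "t \<in> D" "e s = e t"
    then have "s n = t n" for n using ternary_sum_inj[of s t n] by (simp add: e_def D)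
    then show "s = t" by blast
  qed
  obtain e' where e': "\<And>s. s \<in> D \<Longrightarrow> e' (e s) = s"
    using inj by (metis inv_into_f_f)
  have ce': "continuous_on (e ` D) e'"
    by (rule continuous_on_inv[OF ce cD]) (simp add: e')
  obtain M where M: "0 < M" "\<And>x. x \<in> K \<Longrightarrow> norm x < M"
    using bounded_pos_less compact_imp_bounded[OF assms] by metis
  define r where "r i n = prod_encode (to_nat_on Basis (i::'b), n)" for i n
  define g where "g s = (\<Sum>i\<in>Basis. (M * ((\<Sum>n. s (r i n) / 2 ^ n) - 1)) *\<^sub>R (i::'b))"
    for s :: "nat \<Rightarrow> real"
  have cg: "continuous_on D g"
    unfolding g_def D_def by (intro continuous_intros continuous_on_digit_sum) auto
  define C where "C = {t \<in> e ` D. g (e' t) \<in> K}"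
  have cge: "continuous_on (e ` D) (\<lambda>t. g (e' t))"
    by (rule continuous_on_compose2[OF cg ce']) (auto simp: e')
  show ?thesis
  proof
    have "compact (e ` D)" by (rule compact_continuous_image[OF ce cD])
    moreover have "closedin (top_of_set (e ` D)) C"
      unfolding C_def
      using continuous_closedin_preimage[OF cge compact_imp_closed[OF assms]]
      by (simp add: vimage_def Int_def)
    ultimately show "compact C" using closedin_compact by blast
    show "continuous_on C (\<lambda>t. g (e' t))"
      by (rule continuous_on_subset[OF cge]) (auto simp: C_def)
    show "(\<lambda>t. g (e' t)) ` C = K"
    proof
      show "K \<subseteq> (\<lambda>t. g (e' t)) ` C"
      proof
        fix x assume x: "x \<in> K"
        have "\<forall>i\<in>Basis. \<exists>d. (\<forall>n. d n \<in> {0,1::real}) \<and> (\<Sum>n. d n / 2 ^ n) = x \<bullet> i / M + 1"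
        proof
          fix i :: 'b assume i: "i \<in> Basis"
          have "\<bar>x \<bullet> i\<bar> < M" using Basis_le_norm[OF i, of x] M(2)[OF x] by linarith
          \<comment> \<open>This rescaling is inverted by \<open>g\<close>. The strict inequality
            \<open>norm x < M\<close> keeps the value below 1, as \<open>binary_expansion\<close>
            demands.\<close>
          then have "0 \<le> (x \<bullet> i / M + 1) / 2" "(x \<bullet> i / M + 1) / 2 < 1"
            using M(1) by (auto simp: field_simps)
          then obtain d where "\<And>n. d n \<in> {0,1}" "(\<Sum>n. d n / 2 ^ n) = 2 * ((x \<bullet> i / M + 1) / 2)"
            by (rule binary_expansion) blast
          then show "\<exists>d. (\<forall>n. d n \<in> {0,1::real}) \<and> (\<Sum>n. d n / 2 ^ n) = x \<bullet> i / M + 1"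
            by (intro exI[of _ d]) simp
        qed
        from bchoice[OF this] obtain d where d: "\<And>i n. i \<in> Basis \<Longrightarrow> d i n \<in> {0,1::real}"
            "\<And>i. i \<in> Basis \<Longrightarrow> (\<Sum>n. d i n / 2 ^ n) = x \<bullet> i / M + 1"
          by blast
        \<comment> \<open>The digit sequences of all coordinates are interleaved by decoding
          \<open>k\<close> into a basis vector and a digit position, the inverse of the encoding
          \<open>r\<close>.\<close>
        define s where "s k = d (from_nat_into Basis (fst (prod_decode k))) (snd (prod_decode k))" for k
        have s: "s \<in> D"
          unfolding D s_def using d(1) from_nat_into[OF nonempty_Basis] by blast
        have "s (r i n) = d i n" if "i \<in> Basis" for i n
          using that by (simp add: s_def r_def countable_finite)
        then have "g s = (\<Sum>i\<in>Basis. (x \<bullet> i) *\<^sub>R i)"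
          unfolding g_def using M(1) by (intro sum.cong) (auto simp: d(2))
        then have "g s = x" by (simp add: euclidean_representation)
        then show "x \<in> (\<lambda>t. g (e' t)) ` C"
          using s x by (auto simp: C_def e' intro!: image_eqI[of _ _ "e s"])
      qed
    qed (auto simp: C_def)
  qed
qed

section \<open>Sequential compactness of probability measures\<close>

lemma borel_section:
  fixes \<phi> :: "real \<Rightarrow> 'b::euclidean_space"
  assumes C: "compact C" and \<phi>: "continuous_on C \<phi>"
  obtains \<psi> where "\<psi> \<in> borel_measurable (restrict_space borel (\<phi> ` C))"
    "\<And>x. x \<in> \<phi> ` C \<Longrightarrow> \<psi> x \<in> C \<and> \<phi> (\<psi> x) = x"
proof
  \<comment> \<open>The least preimage is lower semicontinuous, hence Borel.\<close>
  define \<psi> where "\<psi> x = Inf {t \<in> C. \<phi> t = x}" for x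
  have min: "\<psi> x \<in> C \<and> \<phi> (\<psi> x) = x \<and> (\<forall>t\<in>C. \<phi> t = x \<longrightarrow> \<psi> x \<le> t)" if x: "x \<in> \<phi> ` C" for x
  proof -
    have eq: "{t \<in> C. \<phi> t = x} = C \<inter> \<phi> -` {x}" by auto
    have "closedin (top_of_set C) (C \<inter> \<phi> -` {x})"
      by (rule continuous_closedin_preimage[OF \<phi>]) simp
    then have c: "compact {t \<in> C. \<phi> t = x}" unfolding eq using closedin_compact[OF C] by blast
    moreover have ne: "{t \<in> C. \<phi> t = x} \<noteq> {}" using x by auto
    moreover have bd: "bdd_below {t \<in> C. \<phi> t = x}"
      using c by (simp add: bounded_imp_bdd_below compact_imp_bounded)
    ultimately have "\<psi> x \<in> {t \<in> C. \<phi> t = x}"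
      unfolding \<psi>_def by (intro closed_contains_Inf compact_imp_closed)
    then show ?thesis using cInf_lower[OF _ bd] by (auto simp: \<psi>_def)
  qed
  then show "\<And>x. x \<in> \<phi> ` C \<Longrightarrow> \<psi> x \<in> C \<and> \<phi> (\<psi> x) = x" by blast
  show "\<psi> \<in> borel_measurable (restrict_space borel (\<phi> ` C))"
    unfolding borel_measurable_iff_le
  proof
    fix a
    \<comment> \<open>Since the least preimage is attained, \<open>\<psi> x \<le> a\<close> says
      exactly that some preimage is at most \<open>a\<close>. Sublevel sets are thus continuous
      images of compact sets.\<close>
    have "{x \<in> \<phi> ` C. \<psi> x \<le> a} = \<phi> ` (C \<inter> {..a})"
    proof (intro subset_antisym subsetI)
      fix x assume "x \<in> {x \<in> \<phi> ` C. \<psi> x \<le> a}"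
      then show "x \<in> \<phi> ` (C \<inter> {..a})"
        using min[of x] by (intro image_eqI[of _ _ "\<psi> x"]) auto
    next
      fix x assume "x \<in> \<phi> ` (C \<inter> {..a})"
      then obtain t where "t \<in> C" "t \<le> a" "x = \<phi> t" by auto
      then show "x \<in> {x \<in> \<phi> ` C. \<psi> x \<le> a}" using min[of x] by force
    qed
    moreover have "compact (\<phi> ` (C \<inter> {..a}))"
      using C by (intro compact_continuous_image continuous_on_subset[OF \<phi>] compact_Int_closed) auto
    moreover have "\<phi> ` C \<in> sets borel"
      using compact_continuous_image[OF \<phi> C] by (simp add: borel_compact)
    ultimately show "{w \<in> space (restrict_space borel (\<phi> ` C)). \<psi> w \<le> a}
        \<in> sets (restrict_space borel (\<phi> ` C))"
      by (simp add: space_restrict_space sets_restrict_space_iff borel_compact image_mono)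
  qed
qed

text \<open>Although \<open>\<psi>\<close> is merely Borel, a continuous \<open>h\<close> on
  \<open>K\<close> satisfies \<open>h x = h (\<phi> (\<psi> x))\<close>, and the composition of
  \<open>h\<close> with \<open>\<phi>\<close> is continuous on \<open>C\<close>. Extended to the
  line, it is a legitimate test function for the weak convergence of the pushed measures. Tightness
  is automatic because these all live on the bounded set \<open>C\<close>.\<close>

theorem prob_sequentially_compact:
  fixes M :: "nat \<Rightarrow> 'b::euclidean_space measure"
  assumes K: "compact K" and M: "\<And>n. prob_space (M n)"
    and sets_M [measurable_cong]: "\<And>n. sets (M n) = sets (restrict_space borel K)"
  obtains r N where "strict_mono (r :: nat \<Rightarrow> nat)" "prob_space N"
    "sets N = sets (restrict_space borel K)"
    "\<And>h :: 'b \<Rightarrow> real. continuous_on K h \<Longrightarrow> (\<lambda>n. \<integral>x. h x \<partial>M (r n)) \<longlonglongrightarrow> (\<integral>x. h x \<partial>N)"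
proof -
  interpret M: prob_space "M n" for n by (rule M)
  have space_M: "space (M n) = K" for n
    using sets_eq_imp_space_eq[OF sets_M] by (simp add: space_restrict_space)
  obtain C :: "real set" and \<phi> where C: "compact C" "continuous_on C \<phi>" "\<phi> ` C = K"
    by (rule compact_continuous_image_of_real_compact[OF K])
  obtain \<psi> where \<psi>: "\<psi> \<in> borel_measurable (restrict_space borel K)"
    "\<And>x. x \<in> K \<Longrightarrow> \<psi> x \<in> C \<and> \<phi> (\<psi> x) = x"
    using borel_section[OF C(1,2)] unfolding C(3) by blast
  have \<psi>_meas [measurable]: "\<psi> \<in> borel_measurable (M n)" for n
    using \<psi>(1) measurable_cong_sets[OF sets_M refl] by blast
  obtain k0 where k0: "k0 \<in> K" using M.not_empty space_M by auto
  then have C_ne: "C \<noteq> {}" using C(3) by auto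
  define D where "D n = distr (M n) borel \<psi>" for n
  have rd: "real_distribution (D n)" for n unfolding D_def by simp
  have int_D: "(\<integral>t. g t \<partial>D n) = (\<integral>x. g (\<psi> x) \<partial>M n)" if "continuous_on UNIV g"
    for g :: "real \<Rightarrow> real" and n
    unfolding D_def using that by (intro integral_distr borel_measurable_continuous_onI \<psi>_meas)
  obtain B where B: "0 < B" "\<And>t. t \<in> C \<Longrightarrow> \<bar>t\<bar> \<le> B"
    using compact_imp_bounded[OF C(1)] by (auto simp: bounded_pos)
  \<comment> \<open>The interval is open on the left, so its left end is moved past
    \<open>-B\<close> to contain all of \<open>C\<close>.\<close>
  have "measure (D n) {-B-1<..B} = 1" for n
  proof -
    have "\<psi> -` {-B-1<..B} \<inter> space (M n) = space (M n)"
      using \<psi>(2) B(2) by (force simp: space_M)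
    then show ?thesis
      unfolding D_def by (subst measure_distr) (auto simp: M.prob_space)
  qed
  then have "\<exists>a b. a < b \<and> (\<forall>n. 1 - \<epsilon> < measure (D n) {a<..b})" if "0 < \<epsilon>" for \<epsilon> :: real
    using that B(1) by (intro exI[of _ "-B-1"] exI[of _ B]) auto
  then have "tight D" unfolding tight_def using rd by blast
  from tight_imp_convergent_subsubsequence[OF this strict_mono_id]
  obtain r L where r: "strict_mono r" and L: "real_distribution L"
    and conv: "weak_conv_m (D \<circ> id \<circ> r) L"
    by blast
  interpret L: real_distribution L by fact
  have lim: "(\<lambda>n. \<integral>x. g (\<psi> x) \<partial>M (r n)) \<longlonglongrightarrow> (\<integral>t. g t \<partial>L)"
    if g: "continuous_on UNIV g" "\<And>t. \<bar>g t\<bar> \<le> b" for g :: "real \<Rightarrow> real" and b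
  proof -
    have "(\<lambda>n. \<integral>t. g t \<partial>(D \<circ> id \<circ> r) n) \<longlonglongrightarrow> (\<integral>t. g t \<partial>L)"
      by (rule weak_conv_imp_integral_bdd_continuous_conv[OF _ L conv, where B = b])
         (use g rd in \<open>auto simp: continuous_on_eq_continuous_at\<close>)
    then show ?thesis by (simp add: int_D[OF g(1)])
  qed
  have AE_C: "AE t in L. t \<in> C"
  proof -
    \<comment> \<open>A bounded continuous function whose zero set is the closed nonempty set
      \<open>C\<close>: its integral vanishes along the sequence, hence in the limit, so
      \<open>L\<close> is concentrated on \<open>C\<close>.\<close>
    let ?d = "\<lambda>t. min 1 (infdist t C)"
    have cont: "continuous_on UNIV ?d" by (intro continuous_intros)
    have "?d (\<psi> x) = 0" if "x \<in> K" for x using \<psi>(2)[OF that] by simp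
    then have "(\<integral>x. ?d (\<psi> x) \<partial>M n) = 0" for n
      by (intro integral_eq_zero_AE AE_I2) (auto simp: space_M)
    then have "(\<lambda>n. 0) \<longlonglongrightarrow> (\<integral>t. ?d t \<partial>L)"
      using lim[OF cont, of 1] by (simp add: abs_of_nonneg infdist_nonneg)
    then have "(\<integral>t. ?d t \<partial>L) = 0" using LIMSEQ_unique tendsto_const by blast
    moreover have "integrable L ?d"
      using borel_measurable_continuous_onI[OF cont]
      by (intro L.integrable_const_bound[of _ 1]) (auto simp: infdist_nonneg)
    ultimately have "AE t in L. ?d t = 0"
      by (subst (asm) integral_nonneg_eq_0_iff_AE) (auto simp: infdist_nonneg)
    then show ?thesis
    proof eventually_elim
      case (elim t)
      then have "infdist t C = 0" by (auto simp: min_def split: if_splits)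
      then show ?case using in_closed_iff_infdist_zero[OF compact_imp_closed[OF C(1)] C_ne] by simp
    qed
  qed
  \<comment> \<open>\<open>k0\<close> is an arbitrary default in \<open>K\<close> that makes the map
    total with values in \<open>K\<close>; it is used only on an \<open>L\<close>-null set.\<close>
  define \<phi>' where "\<phi>' t = (if t \<in> C then \<phi> t else k0)" for t
  have "\<phi>' \<in> borel_measurable borel"
    unfolding \<phi>'_def using C by (intro borel_measurable_continuous_on_if) (auto simp: borel_compact)
  moreover have in_K: "\<phi>' t \<in> K" for t using C(3) k0 by (auto simp: \<phi>'_def)
  ultimately have \<phi>' [measurable]: "\<phi>' \<in> measurable L (restrict_space borel K)"
    by (intro measurable_restrict_space2) auto
  show ?thesis
  proof (rule that[OF r])
    show "prob_space (distr L (restrict_space borel K) \<phi>')" by (rule L.prob_space_distr[OF \<phi>'])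
    show "sets (distr L (restrict_space borel K) \<phi>') = sets (restrict_space borel K)" by simp
    fix h :: "'b \<Rightarrow> real" assume h: "continuous_on K h"
    have h_meas [measurable]: "h \<in> borel_measurable (restrict_space borel K)"
      using h by (rule borel_measurable_continuous_on_restrict)
    have h\<phi>: "continuous_on C (\<lambda>t. h (\<phi> t))"
      by (rule continuous_on_compose2[OF h C(2)]) (use C(3) in auto)
    obtain b where b: "0 \<le> b" "\<And>x. x \<in> K \<Longrightarrow> \<bar>h x\<bar> \<le> b"
      using compact_imp_bounded[OF compact_continuous_image[OF h K]]
      by (auto simp: bounded_pos intro: less_imp_le)
    \<comment> \<open>Tietze keeps the bound \<open>b\<close>, which the weak limit of integrals
      requires on the whole line.\<close>
    obtain g where g: "continuous_on UNIV g" "\<And>t. t \<in> C \<Longrightarrow> g t = h (\<phi> t)"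
        "\<And>t. norm (g t) \<le> b"
    proof (rule Tietze[OF h\<phi>, of UNIV b])
      show "norm (h (\<phi> t)) \<le> b" if "t \<in> C" for t using b(2) that C(3) by auto
    qed (use C(1) b(1) in \<open>auto simp: compact_imp_closed\<close>)
    have "(\<integral>x. h x \<partial>M n) = (\<integral>x. g (\<psi> x) \<partial>M n)" for n
      by (rule Bochner_Integration.integral_cong) (use \<psi>(2) g(2) in \<open>auto simp: space_M\<close>)
    moreover have "(\<integral>x. h x \<partial>distr L (restrict_space borel K) \<phi>') = (\<integral>t. h (\<phi>' t) \<partial>L)"
      by (rule integral_distr[OF \<phi>' h_meas])
    moreover have "\<dots> = (\<integral>t. g t \<partial>L)"
    proof (rule integral_cong_AE)
      show "g \<in> borel_measurable L"
        using borel_measurable_continuous_onI[OF g(1)] by simp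
      show "AE t in L. h (\<phi>' t) = g t"
        using AE_C by eventually_elim (simp add: \<phi>'_def g(2))
    qed measurable
    ultimately show "(\<lambda>n. \<integral>x. h x \<partial>M (r n)) \<longlonglongrightarrow> (\<integral>x. h x \<partial>distr L (restrict_space borel K) \<phi>')"
      using lim[OF g(1), of b] g(3) by simp
  qed
qed

text \<open>Finite intersections of a countable basis form a countable pi-system. The empty
  intersection supplies \<open>UNIV\<close>, which later serves as the exhausting sequence in the
  uniqueness theorem for measures.\<close>

lemma countable_Int_stable_generator:
  obtains B :: "'a::second_countable_topology set set"
  where "countable B" "UNIV \<in> B" "Int_stable B" "\<And>U. U \<in> B \<Longrightarrow> open U"
    "sets borel = sigma_sets UNIV B"
proof -
  obtain B :: "'a set set" where B: "countable B" "topological_basis B"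
    using ex_countable_basis by auto
  define B' where "B' = Inter ` {b. finite b \<and> b \<subseteq> B}"
  have op: "open U" if "U \<in> B'" for U
    using that topological_basis_open[OF B(2)] by (auto simp: B'_def)
  have sub: "B \<subseteq> B'"
  proof
    fix U assume "U \<in> B"
    then show "U \<in> B'" unfolding B'_def by (intro image_eqI[of _ _ "{U}"]) auto
  qed
  show ?thesis
  proof (rule that[of B'])
    show "countable B'"
      unfolding B'_def by (intro countable_image countable_Collect_finite_subset B)
    show "UNIV \<in> B'" unfolding B'_def by (intro image_eqI[of _ _ "{}"]) auto
    show "Int_stable B'"
    proof (rule Int_stableI)
      fix U V assume "U \<in> B'" "V \<in> B'"
      then obtain a b where "finite a" "a \<subseteq> B" "U = \<Inter>a" "finite b" "b \<subseteq> B" "V = \<Inter>b"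
        by (auto simp: B'_def)
      then show "U \<inter> V \<in> B'"
        unfolding B'_def by (intro image_eqI[of _ _ "a \<union> b"]) auto
    qed
    have "sets borel = sigma_sets UNIV B"
      by (subst borel_eq_countable_basis[OF B]) simp
    also have "\<dots> \<subseteq> sigma_sets UNIV B'" by (rule sigma_sets_mono') (rule sub)
    finally show "sets borel = sigma_sets UNIV B'"
      using sets.sigma_sets_subset[of B' "borel :: 'a measure"] op borel_open by auto
  qed (rule op)
qed

text \<open>The functions \<open>min 1 (m * infdist x (- U))\<close> converge pointwise to the
  indicator of the open set \<open>U\<close>, so their integrals determine the measure of every
  member of a countable pi-system. They are defined on the whole space, so the same sequence serves
  all subsets \<open>S\<close>.\<close>

lemma countable_measure_determining_continuous:
  obtains V :: "nat \<Rightarrow> 'a::{metric_space, second_countable_topology} \<Rightarrow> real"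
  where "\<And>k. continuous_on UNIV (V k)"
    "\<And>S M N. finite_measure M \<Longrightarrow> finite_measure N \<Longrightarrow>
      sets M = sets (restrict_space borel S) \<Longrightarrow> sets N = sets (restrict_space borel S) \<Longrightarrow>
      (\<And>k. (\<integral>x. V k x \<partial>M) = (\<integral>x. V k x \<partial>N)) \<Longrightarrow> M = N"
proof -
  obtain B :: "'a set set"
    where B: "countable B" "UNIV \<in> B" "Int_stable B" "\<And>U. U \<in> B \<Longrightarrow> open U"
      "sets borel = sigma_sets UNIV B"
    by (rule countable_Int_stable_generator) blast
  \<comment> \<open>\<open>UNIV\<close> is treated apart because \<open>infdist\<close> to the empty
    set is 0 by convention, which would give the function 0 instead of 1.\<close>
  define v :: "'a set \<Rightarrow> nat \<Rightarrow> 'a \<Rightarrow> real"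
    where "v U m x = (if U = UNIV then 1 else min 1 (real m * infdist x (- U)))" for U m x
  define V where "V k = v (from_nat_into B (fst (prod_decode k))) (snd (prod_decode k))" for k
  have v_cont: "continuous_on UNIV (v U m)" for U m
    unfolding v_def by (cases "U = UNIV") (auto intro!: continuous_intros)
  have v_bound: "\<bar>v U m x\<bar> \<le> 1" for U m x
    using mult_nonneg_nonneg[OF of_nat_0_le_iff infdist_nonneg, of m x "- U"] by (simp add: v_def)
  have v_lim: "(\<lambda>m. v U m x) \<longlonglongrightarrow> indicator U x" if U: "U \<in> B" for U x
  proof (cases "x \<in> U \<and> U \<noteq> UNIV")
    case True
    then have pos: "0 < infdist x (- U)"
      using B(4)[OF U] in_closed_iff_infdist_zero[of "- U" x] infdist_nonneg[of x "- U"]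
      by (fastforce simp: closed_Compl)
    obtain m0 where m0: "1 \<le> real m0 * infdist x (- U)"
      using ex_less_of_nat_mult[OF pos, of 1] by (auto intro: less_imp_le)
    have "v U m x = 1" if "m0 \<le> m" for m
    proof -
      have "real m0 * infdist x (- U) \<le> real m * infdist x (- U)"
        using that pos by (intro mult_right_mono) auto
      then show ?thesis using m0 by (simp add: v_def)
    qed
    then have "\<forall>\<^sub>F m in sequentially. v U m x = indicator U x"
      using True by (auto simp: eventually_sequentially)
    then show ?thesis by (rule tendsto_eventually)
  next
    case False
    then have "v U m x = indicator U x" for m by (auto simp: v_def)
    then show ?thesis by simp
  qed
  show ?thesis
  proof (rule that[of V])
    show "continuous_on UNIV (V k)" for k unfolding V_def by (rule v_cont)
    fix S and M N :: "'a measure"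
    assume fin: "finite_measure M" "finite_measure N"
      and sets: "sets M = sets (restrict_space borel S)" "sets N = sets (restrict_space borel S)"
      and eq: "\<And>k. (\<integral>x. V k x \<partial>M) = (\<integral>x. V k x \<partial>N)"
    have space: "space M = S" "space N = S"
      using sets[THEN sets_eq_imp_space_eq] by (simp_all add: space_restrict_space)
    have id: "(\<lambda>x. x) \<in> borel_measurable L" if "sets L = sets (restrict_space borel S)"
      for L :: "'a measure"
      using that by (simp add: measurable_cong_sets[OF that refl] measurable_restrict_space1)
    have lim: "(\<lambda>m. \<integral>x. v U m x \<partial>L) \<longlonglongrightarrow> measure L (U \<inter> S)"
      if U: "U \<in> B" and L: "finite_measure L" "sets L = sets (restrict_space borel S)"
        "space L = S" for U and L :: "'a measure"
    proof -
      interpret finite_measure L by (rule L)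
      have US: "U \<inter> S \<in> sets L"
        using B(4)[OF U] unfolding L(2) by (auto simp: sets_restrict_space)
      have "(\<lambda>m. \<integral>x. v U m x \<partial>L) \<longlonglongrightarrow> (\<integral>x. indicator (U \<inter> S) x \<partial>L)"
      proof (rule integral_dominated_convergence[where w = "\<lambda>_. 1"])
        show "v U m \<in> borel_measurable L" for m
          using measurable_compose[OF id[OF L(2)] borel_measurable_continuous_onI[OF v_cont]] .
        show "AE x in L. (\<lambda>m. v U m x) \<longlonglongrightarrow> indicator (U \<inter> S) x"
          by (rule AE_I2) (use v_lim[OF U] L(3) in \<open>simp add: indicator_def\<close>)
      qed (use US v_bound in auto)
      then show ?thesis using US by simp
    qed
    have meas_eq: "measure M (U \<inter> S) = measure N (U \<inter> S)" if U: "U \<in> B" for U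
    proof -
      obtain j where j: "from_nat_into B j = U" using from_nat_into_surj[OF B(1) U] by auto
      have "(\<integral>x. v U m x \<partial>M) = (\<integral>x. v U m x \<partial>N)" for m
        using eq[of "prod_encode (j, m)"] by (simp add: V_def j)
      then show ?thesis
        using LIMSEQ_unique[OF lim[OF U fin(1) sets(1) space(1)]] lim[OF U fin(2) sets(2) space(2)]
        by simp
    qed
    interpret M: finite_measure M by (rule fin)
    interpret N: finite_measure N by (rule fin)
    have ed: "emeasure (distr L borel (\<lambda>x. x)) U = emeasure L (U \<inter> S)"
      if "sets L = sets (restrict_space borel S)" "space L = S" "U \<in> sets borel"
      for L :: "'a measure" and U
      by (subst emeasure_distr) (use that id in auto)
    \<comment> \<open>Both measures are pushed to the whole space, where the pi-system lives;
      intersecting with \<open>S\<close> brings the equality back.\<close>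
    have "distr M borel (\<lambda>x. x) = distr N borel (\<lambda>x. x)"
    proof (rule measure_eqI_generator_eq[OF B(3), of UNIV _ _ "\<lambda>_. UNIV"])
      fix U assume U: "U \<in> B"
      then show "emeasure (distr M borel (\<lambda>x. x)) U = emeasure (distr N borel (\<lambda>x. x)) U"
        using B(4) meas_eq[OF U]
        by (simp add: ed sets space M.emeasure_eq_measure N.emeasure_eq_measure)
    qed (use B in \<open>auto simp: ed sets space\<close>)
    then have all: "emeasure M (U \<inter> S) = emeasure N (U \<inter> S)" if "U \<in> sets borel" for U
      using ed[OF sets(1) space(1) that] ed[OF sets(2) space(2) that] by simp
    show "M = N"
    proof (rule measure_eqI)
      fix A assume "A \<in> sets M"
      then obtain U where "U \<in> sets borel" "A = U \<inter> S"
        unfolding sets by (auto simp: sets_restrict_space)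
      then show "emeasure M A = emeasure N A" using all by simp
    qed (simp add: sets)
  qed
qed

section \<open>A finite minimax theorem\<close>

text \<open>A hyperplane separates the attainable value pairs from the open quadrant below
  \<open>(s, s)\<close>, and its normal, scaled to coordinate sum 1, gives the weights. The
  hypothesis is convexity in Ky Fan's sense: \<open>A\<close> carries no linear structure, only a
  point with values below each mixture.\<close>

lemma two_function_minimax:
  fixes f g :: "'p \<Rightarrow> real"
  assumes cvx: "\<And>a b t. a \<in> A \<Longrightarrow> b \<in> A \<Longrightarrow> 0 \<le> t \<Longrightarrow> t \<le> 1 \<Longrightarrow>
      \<exists>c\<in>A. f c \<le> t * f a + (1 - t) * f b \<and> g c \<le> t * g a + (1 - t) * g b"
    and ge: "\<And>a. a \<in> A \<Longrightarrow> s \<le> f a \<or> s \<le> g a"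
  obtains l where "0 \<le> l" "l \<le> 1" "\<And>a. a \<in> A \<Longrightarrow> s \<le> l * f a + (1 - l) * g a"
proof (cases "A = {}")
  case True
  then show ?thesis using that[of 0] by auto
next
  case False
  \<comment> \<open>Taking all pairs above an attained one turns the inequalities in
    \<open>cvx\<close> into genuine convexity, and it forces the normal to be nonnegative.\<close>
  define W where "W = {z. \<exists>a\<in>A. f a \<le> fst z \<and> g a \<le> snd z}"
  define T where "T = {z :: real \<times> real. fst z < s \<and> snd z < s}"
  have "convex W"
  proof (rule convexI)
    fix x y :: "real \<times> real" and u v :: real
    assume *: "x \<in> W" "y \<in> W" "0 \<le> u" "0 \<le> v" "u + v = 1"
    then obtain a b where ab: "a \<in> A" "f a \<le> fst x" "g a \<le> snd x" "b \<in> A" "f b \<le> fst y" "g b \<le> snd y"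
      by (auto simp: W_def)
    have v: "v = 1 - u" using * by simp
    obtain c where c: "c \<in> A" "f c \<le> u * f a + v * f b" "g c \<le> u * g a + v * g b"
      using cvx[OF ab(1) ab(4), of u] * v by auto
    have "u * f a + v * f b \<le> u * fst x + v * fst y" "u * g a + v * g b \<le> u * snd x + v * snd y"
      using ab * by (auto intro!: add_mono mult_left_mono)
    then show "u *\<^sub>R x + v *\<^sub>R y \<in> W"
      unfolding W_def using c by (auto intro!: bexI[of _ c])
  qed
  moreover have "convex T"
  proof -
    have "T = {..<s} \<times> {..<s}" by (auto simp: T_def)
    then show ?thesis by (simp add: convex_Times)
  qed
  moreover have "W \<noteq> {}" using False by (auto simp: W_def)
  moreover have "(s - 1, s - 1) \<in> T" by (simp add: T_def)
  moreover have "T \<inter> W = {}" using ge by (force simp: W_def T_def)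
  ultimately obtain n b where nb: "n \<noteq> 0" "\<And>x. x \<in> T \<Longrightarrow> n \<bullet> x \<le> b" "\<And>x. x \<in> W \<Longrightarrow> b \<le> n \<bullet> x"
    using separating_hyperplane_sets[of T W] by blast
  obtain p q where n: "n = (p, q)" by (cases n)
  have lt: "p * x + q * y \<le> b" if "x < s" "y < s" for x y
    using nb(2)[of "(x,y)"] that by (simp add: T_def n)
  have gt: "b \<le> p * x + q * y" if "a \<in> A" "f a \<le> x" "g a \<le> y" for a x y
    using nb(3)[of "(x,y)"] that by (auto simp: W_def n)
  obtain a0 where a0: "a0 \<in> A" using False by auto
  have p: "0 \<le> p"
  proof (rule ccontr)
    assume "\<not> 0 \<le> p"
    then have p: "p < 0" by simp
    \<comment> \<open>Raising the first coordinate stays inside \<open>W\<close>. With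
      \<open>p < 0\<close>, this \<open>y\<close> pushes the linear functional to
      \<open>b - 1\<close> or lower, below its bound on \<open>W\<close>.\<close>
    define y where "y = max 0 ((b - 1 - p * f a0 - q * g a0) / p)"
    have "p * y \<le> b - 1 - p * f a0 - q * g a0"
      using mult_left_mono_neg[of "(b - 1 - p * f a0 - q * g a0) / p" y p] p by (auto simp: y_def)
    moreover have "b \<le> p * (f a0 + y) + q * g a0" by (rule gt[OF a0]) (auto simp: y_def)
    ultimately show False by (simp add: algebra_simps)
  qed
  have q: "0 \<le> q"
  proof (rule ccontr)
    assume "\<not> 0 \<le> q"
    then have p: "q < 0" by simp
    define y where "y = max 0 ((b - 1 - p * f a0 - q * g a0) / q)"
    have "q * y \<le> b - 1 - p * f a0 - q * g a0"
      using mult_left_mono_neg[of "(b - 1 - p * f a0 - q * g a0) / q" y q] p by (auto simp: y_def)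
    moreover have "b \<le> p * f a0 + q * (g a0 + y)" by (rule gt[OF a0]) (auto simp: y_def)
    ultimately show False by (simp add: algebra_simps)
  qed
  have pq: "0 < p + q" using p q nb(1) n by (auto simp: zero_prod_def)
  \<comment> \<open>The corner \<open>(s, s)\<close> is not in the open quadrant \<open>T\<close>,
    so it is approached along the diagonal.\<close>
  have sb: "(p + q) * s \<le> b"
  proof (rule field_le_epsilon)
    fix e :: real assume e: "0 < e"
    have "p * (s - e / (p + q)) + q * (s - e / (p + q)) \<le> b"
      using e pq by (intro lt) auto
    then have "(p + q) * s - (p + q) * (e / (p + q)) \<le> b"
      by (simp add: algebra_simps add_divide_distrib)
    then show "(p + q) * s \<le> b + e" using pq by simp
  qed
  show ?thesis
  proof (rule that[of "p / (p + q)"])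
    show "0 \<le> p / (p + q)" "p / (p + q) \<le> 1" using p q pq by auto
    fix a assume a: "a \<in> A"
    have "(p + q) * s \<le> p * f a + q * g a" using gt[OF a, of "f a" "g a"] sb by simp
    then have "s \<le> (p * f a + q * g a) / (p + q)" using pq by (simp add: pos_le_divide_eq mult.commute)
    moreover have "1 - p / (p + q) = q / (p + q)" using pq by (simp add: field_simps)
    ultimately show "s \<le> p / (p + q) * f a + (1 - p / (p + q)) * g a"
      by (simp add: add_divide_distrib)
  qed
qed

text \<open>Induction on the index set, with \<open>A\<close> generalised: weights for
  \<open>I\<close> are found on the points where \<open>f j\<close> fails to reach \<open>s\<close>,
  and their weighted sum is then combined with \<open>f j\<close> by the case of two
  functions.\<close>

lemma finite_minimax:
  fixes f :: "'i \<Rightarrow> 'p \<Rightarrow> real"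
  assumes "finite I" "I \<noteq> {}"
    and "\<And>a b t. a \<in> A \<Longrightarrow> b \<in> A \<Longrightarrow> 0 \<le> t \<Longrightarrow> t \<le> 1 \<Longrightarrow>
      \<exists>c\<in>A. \<forall>i\<in>I. f i c \<le> t * f i a + (1 - t) * f i b"
    and "\<And>a. a \<in> A \<Longrightarrow> \<exists>i\<in>I. s \<le> f i a"
  shows "\<exists>w. (\<forall>i\<in>I. 0 \<le> w i) \<and> sum w I = 1 \<and> (\<forall>a\<in>A. s \<le> (\<Sum>i\<in>I. w i * f i a))"
  using assms
proof (induction I arbitrary: A rule: finite_ne_induct)
  case (singleton i)
  then show ?case by (intro exI[of _ "\<lambda>_. 1"]) auto
next
  case (insert j I)
  define A' where "A' = {a \<in> A. f j a < s}"
  have "\<exists>w. (\<forall>i\<in>I. 0 \<le> w i) \<and> sum w I = 1 \<and> (\<forall>a\<in>A'. s \<le> (\<Sum>i\<in>I. w i * f i a))"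
  proof (rule insert.IH)
    fix a b and t :: real
    assume *: "a \<in> A'" "b \<in> A'" "0 \<le> t" "t \<le> 1"
    then obtain c where c: "c \<in> A" "\<forall>i\<in>insert j I. f i c \<le> t * f i a + (1 - t) * f i b"
      using insert.prems(1)[of a b t] by (auto simp: A'_def)
    \<comment> \<open>The strict inequality in \<open>A'\<close> survives mixing, so
      \<open>A'\<close> inherits the convexity hypothesis.\<close>
    have "t * f j a + (1 - t) * f j b < s"
      using * by (intro convex_bound_lt) (auto simp: A'_def)
    then have "c \<in> A'" using c by (auto simp: A'_def)
    then show "\<exists>c\<in>A'. \<forall>i\<in>I. f i c \<le> t * f i a + (1 - t) * f i b" using c by auto
  next
    fix a assume "a \<in> A'"
    then show "\<exists>i\<in>I. s \<le> f i a" using insert.prems(2)[of a] by (auto simp: A'_def)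
  qed
  then obtain w where w: "\<And>i. i \<in> I \<Longrightarrow> 0 \<le> w i" "sum w I = 1"
      "\<And>a. a \<in> A' \<Longrightarrow> s \<le> (\<Sum>i\<in>I. w i * f i a)"
    by auto
  obtain l where l: "0 \<le> l" "l \<le> 1"
    "\<And>a. a \<in> A \<Longrightarrow> s \<le> l * (\<Sum>i\<in>I. w i * f i a) + (1 - l) * f j a"
  proof (rule two_function_minimax[of A "\<lambda>a. \<Sum>i\<in>I. w i * f i a" "f j" s])
    fix a b and t :: real
    assume *: "a \<in> A" "b \<in> A" "0 \<le> t" "t \<le> 1"
    then obtain c where c: "c \<in> A" "\<forall>i\<in>insert j I. f i c \<le> t * f i a + (1 - t) * f i b"
      using insert.prems(1)[of a b t] by auto
    have "(\<Sum>i\<in>I. w i * f i c) \<le> (\<Sum>i\<in>I. w i * (t * f i a + (1 - t) * f i b))"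
      using c w by (intro sum_mono mult_left_mono) auto
    also have "\<dots> = t * (\<Sum>i\<in>I. w i * f i a) + (1 - t) * (\<Sum>i\<in>I. w i * f i b)"
      by (simp add: sum_distrib_left sum.distrib[symmetric] algebra_simps)
    finally show "\<exists>c\<in>A. (\<Sum>i\<in>I. w i * f i c) \<le> t * (\<Sum>i\<in>I. w i * f i a) + (1 - t) * (\<Sum>i\<in>I. w i * f i b)
        \<and> f j c \<le> t * f j a + (1 - t) * f j b"
      using c by auto
  next
    fix a assume "a \<in> A"
    then show "s \<le> (\<Sum>i\<in>I. w i * f i a) \<or> s \<le> f j a"
      using w(3)[of a] by (auto simp: A'_def not_less)
  qed auto
  define w' where "w' i = (if i = j then 1 - l else l * w i)" for i
  have *: "(\<Sum>i\<in>I. w' i * h i) = l * (\<Sum>i\<in>I. w i * h i)" for h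
    unfolding sum_distrib_left
    by (intro sum.cong refl) (use insert.hyps in \<open>auto simp: w'_def\<close>)
  show ?case
  proof (intro exI[of _ w'] conjI ballI)
    show "0 \<le> w' i" if "i \<in> insert j I" for i
      using that l w(1) by (auto simp: w'_def)
    show "sum w' (insert j I) = 1"
      using insert.hyps *[of "\<lambda>_. 1"] w(2) by (simp add: w'_def)
    show "s \<le> (\<Sum>i\<in>insert j I. w' i * f i a)" if "a \<in> A" for a
      using insert.hyps *[of "\<lambda>i. f i a"] l(3)[OF that] by (simp add: w'_def)
  qed
qed

section \<open>Weak-* limits, mixtures and marginals\<close>

text \<open>The topology is given by a subbasis, so the claim follows by induction on the generation
  of \<open>U\<close>; on a subbasic set it is the assumed convergence of one integral.\<close>

lemma wstar_eventually_in:
  assumes U: "openin (wstar S) U" "\<pi> \<in> U" and fsm: "\<And>n. \<sigma> n \<in> fsm S"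
    and lim: "\<And>h. continuous_on S h \<Longrightarrow> (\<lambda>n. sint S (\<sigma> n) h) \<longlonglongrightarrow> sint S \<pi> h"
  shows "\<forall>\<^sub>F n in sequentially. \<sigma> n \<in> U"
proof -
  have "generate_topology_on
      {{\<pi> \<in> fsm S. sint S \<pi> h \<in> U} | h U. continuous_on S h \<and> open (U::real set)} U"
    using U(1) by (simp add: wstar_def openin_topology_generated_by_iff)
  then show ?thesis using U(2)
  proof induction
    case (Int a b)
    then show ?case by (auto intro: eventually_conj)
  next
    case (UN K)
    then obtain k where "k \<in> K" "\<pi> \<in> k" by auto
    then show ?case using UN.IH[of k] by (auto elim: eventually_mono)
  next
    case (Basis s)
    then obtain h V where s: "s = {\<pi> \<in> fsm S. sint S \<pi> h \<in> V}" "continuous_on S h" "open V"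
      by auto
    then have "\<forall>\<^sub>F n in sequentially. sint S (\<sigma> n) h \<in> V"
      using lim[OF s(2)] Basis.prems by (auto simp: tendsto_def)
    then show ?case using fsm s(1) by simp
  qed simp
qed

lemma wstar_lsc_sequentially:
  assumes lsc: "wstar_lsc S F" and fsm: "\<pi> \<in> fsm S" "\<And>n. \<sigma> n \<in> fsm S"
    and lim: "\<And>h. continuous_on S h \<Longrightarrow> (\<lambda>n. sint S (\<sigma> n) h) \<longlonglongrightarrow> sint S \<pi> h"
    and le: "\<forall>\<^sub>F n in sequentially. F (\<sigma> n) \<le> ereal t"
  shows "F \<pi> \<le> ereal t"
proof (rule ccontr)
  assume *: "\<not> F \<pi> \<le> ereal t"
  have top: "\<pi> \<in> topspace (wstar S)"
    unfolding wstar_def topology_generated_by_topspace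
    using fsm(1) by (intro UnionI[of "{\<pi> \<in> fsm S. sint S \<pi> (\<lambda>_. 0) \<in> UNIV}"]) (auto intro: exI[of _ "\<lambda>_. 0"])
  have "openin (wstar S) (topspace (wstar S) - {\<pi> \<in> fsm S. F \<pi> \<le> ereal t})"
    using lsc by (auto simp: wstar_lsc_def closedin_def)
  then have "\<forall>\<^sub>F n in sequentially. \<sigma> n \<in> topspace (wstar S) - {\<pi> \<in> fsm S. F \<pi> \<le> ereal t}"
    by (rule wstar_eventually_in) (use * top fsm(2) lim in auto)
  with le have "\<forall>\<^sub>F n in sequentially. False"
    by eventually_elim (use fsm(2) in auto)
  then show False by simp
qed

text \<open>Linearity of the integral in the measure. Mixtures arise here as set functions, so it is
  obtained by induction over the integrand from indicators upwards.\<close>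

lemma nn_integral_mixture:
  fixes M N L :: "'a measure"
  assumes sets: "sets N = sets M" "sets L = sets M"
    and mix: "\<And>A. A \<in> sets M \<Longrightarrow> emeasure M A = c * emeasure N A + d * emeasure L A"
    and f: "f \<in> borel_measurable M"
  shows "(\<integral>\<^sup>+x. f x \<partial>M) = c * (\<integral>\<^sup>+x. f x \<partial>N) + d * (\<integral>\<^sup>+x. f x \<partial>L)"
  using f
proof (induction rule: borel_measurable_induct)
  have sp: "space N = space M" "space L = space M"
    using sets[THEN sets_eq_imp_space_eq] by auto
  have ms: "u \<in> borel_measurable N" "u \<in> borel_measurable L"
    if "u \<in> borel_measurable M" for u :: "'a \<Rightarrow> ennreal"
    using that measurable_cong_sets[OF sets(1) refl] measurable_cong_sets[OF sets(2) refl] by blast+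
  {
    case (cong f g)
    then have "(\<integral>\<^sup>+x. f x \<partial>M') = (\<integral>\<^sup>+x. g x \<partial>M')" if "space M' = space M" for M'
      using that by (intro nn_integral_cong) auto
    then show ?case using cong sp by simp
  next
    case (set A)
    then show ?case using mix sets by simp
  next
    case (mult u a)
    show ?case using mult ms[OF mult(2)] by (simp add: nn_integral_cmult algebra_simps)
  next
    case (add u v)
    show ?case using add ms[OF add(1)] ms[OF add(3)] by (simp add: nn_integral_add algebra_simps)
  next
    case (seq U)
    note m = ms[OF seq(1)]
    have inc: "incseq (\<lambda>i. a * (\<integral>\<^sup>+x. U i x \<partial>M'))" for a and M' :: "'a measure"
      using \<open>incseq U\<close> by (auto simp: incseq_def le_fun_def intro!: mult_left_mono nn_integral_mono)
    have "(\<integral>\<^sup>+x. (SUP i. U i) x \<partial>M) = (SUP i. \<integral>\<^sup>+x. U i x \<partial>M)"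
      unfolding SUP_apply using seq by (intro nn_integral_monotone_convergence_SUP) auto
    also have "\<dots> = (SUP i. c * (\<integral>\<^sup>+x. U i x \<partial>N)) + (SUP i. d * (\<integral>\<^sup>+x. U i x \<partial>L))"
      using seq by (simp add: ennreal_SUP_add[OF inc inc])
    also have "\<dots> = c * (SUP i. \<integral>\<^sup>+x. U i x \<partial>N) + d * (SUP i. \<integral>\<^sup>+x. U i x \<partial>L)"
      by (simp add: SUP_mult_left_ennreal)
    also have "(SUP i. \<integral>\<^sup>+x. U i x \<partial>N) = (\<integral>\<^sup>+x. (SUP i. U i) x \<partial>N)"
      unfolding SUP_apply using seq m by (intro nn_integral_monotone_convergence_SUP[symmetric]) auto
    also have "(SUP i. \<integral>\<^sup>+x. U i x \<partial>L) = (\<integral>\<^sup>+x. (SUP i. U i) x \<partial>L)"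
      unfolding SUP_apply using seq m by (intro nn_integral_monotone_convergence_SUP[symmetric]) auto
    finally show ?case .
  }
qed

lemma integrable_to_measure:
  assumes "compact S" "\<sigma> \<in> prob_measures S" "continuous_on S (h :: 'a::topological_space \<Rightarrow> real)"
  shows "integrable (to_measure S \<sigma>) h"
proof -
  interpret prob_space "to_measure S \<sigma>" by (rule prob_space_to_measure[OF assms(2)])
  obtain b where b: "\<And>x. x \<in> S \<Longrightarrow> \<bar>h x\<bar> \<le> b"
    using compact_imp_bounded[OF compact_continuous_image[OF assms(3,1)]]
    by (auto simp: bounded_iff)
  have "h \<in> borel_measurable (to_measure S \<sigma>)"
    using borel_measurable_continuous_on_restrict[OF assms(3)]
      measurable_cong_sets[OF sets_to_measure refl] by blast
  then show ?thesis by (rule integrable_const_bound[of _ b, rotated]) (auto simp: b)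
qed

lemma prob_measures_mixture:
  assumes "\<sigma> \<in> prob_measures S" "\<tau> \<in> prob_measures S" "0 \<le> t" "t \<le> 1"
  shows "(\<lambda>A. t * \<sigma> A + (1 - t) * \<tau> A) \<in> prob_measures S"
  using assms unfolding prob_measures_def fsm_def
  by (auto intro!: sums_add sums_mult)

text \<open>Adding a bound \<open>b\<close> makes the integrand nonnegative and reduces the claim to
  \<open>nn_integral_mixture\<close>. All three measures have mass 1, so the shift changes every
  integral by exactly \<open>b\<close> and cancels.\<close>

lemma sint_mixture:
  assumes S: "compact S" and h: "continuous_on S h"
    and \<sigma>: "\<sigma> \<in> prob_measures S" and \<tau>: "\<tau> \<in> prob_measures S" and t: "0 \<le> t" "t \<le> 1"
  shows "sint S (\<lambda>A. t * \<sigma> A + (1 - t) * \<tau> A) h = t * sint S \<sigma> h + (1 - t) * sint S \<tau> h"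
proof -
  let ?\<rho> = "\<lambda>A. t * \<sigma> A + (1 - t) * \<tau> A"
  have \<rho>: "?\<rho> \<in> prob_measures S" by (rule prob_measures_mixture[OF \<sigma> \<tau> t])
  have nn: "0 \<le> \<sigma> A" "0 \<le> \<tau> A" for A using \<sigma> \<tau> by (auto simp: prob_measures_def)
  obtain b where b: "\<And>x. x \<in> S \<Longrightarrow> \<bar>h x\<bar> \<le> b"
    using compact_imp_bounded[OF compact_continuous_image[OF h S]] by (auto simp: bounded_iff)
  have hb: "continuous_on S (\<lambda>x. h x + b)" by (intro continuous_intros h)
  have I: "ennreal (sint S \<nu> h + b) = (\<integral>\<^sup>+x. ennreal (h x + b) \<partial>to_measure S \<nu>)"
      "0 \<le> sint S \<nu> h + b"
    if \<nu>: "\<nu> \<in> prob_measures S" for \<nu>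
  proof -
    interpret prob_space "to_measure S \<nu>" by (rule prob_space_to_measure[OF \<nu>])
    have pos: "0 \<le> h x + b" if "x \<in> S" for x using b[OF that] by linarith
    have eq: "sint S \<nu> h + b = (\<integral>x. h x + b \<partial>to_measure S \<nu>)"
      using integrable_to_measure[OF S \<nu> h] prob_space by (simp add: sint_prob[OF \<nu>])
    show "0 \<le> sint S \<nu> h + b" unfolding eq by (rule integral_nonneg_AE) (auto simp: pos)
    show "ennreal (sint S \<nu> h + b) = (\<integral>\<^sup>+x. ennreal (h x + b) \<partial>to_measure S \<nu>)"
      unfolding eq by (rule nn_integral_eq_integral[symmetric])
        (use integrable_to_measure[OF S \<nu> hb] pos in auto)
  qed
  have "(\<integral>\<^sup>+x. ennreal (h x + b) \<partial>to_measure S ?\<rho>)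
      = ennreal t * (\<integral>\<^sup>+x. ennreal (h x + b) \<partial>to_measure S \<sigma>)
        + ennreal (1 - t) * (\<integral>\<^sup>+x. ennreal (h x + b) \<partial>to_measure S \<tau>)"
  proof (rule nn_integral_mixture)
    show "emeasure (to_measure S ?\<rho>) A
        = ennreal t * emeasure (to_measure S \<sigma>) A + ennreal (1 - t) * emeasure (to_measure S \<tau>) A"
      if "A \<in> sets (to_measure S ?\<rho>)" for A
    proof -
      have "A \<in> Bor S" using that by (simp add: sets_to_measure Bor_def)
      then show ?thesis
        using t nn by (simp add: emeasure_to_measure \<rho> \<sigma> \<tau> ennreal_mult)
    qed
    show "(\<lambda>x. ennreal (h x + b)) \<in> borel_measurable (to_measure S ?\<rho>)"
      using borel_measurable_integrable[OF integrable_to_measure[OF S \<rho> hb]] by simp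
  qed (simp_all add: sets_to_measure)
  then have "ennreal (sint S ?\<rho> h + b)
      = ennreal t * ennreal (sint S \<sigma> h + b) + ennreal (1 - t) * ennreal (sint S \<tau> h + b)"
    by (simp only: I(1) \<rho> \<sigma> \<tau>)
  also have "\<dots> = ennreal (t * (sint S \<sigma> h + b) + (1 - t) * (sint S \<tau> h + b))"
    using t I(2)[OF \<sigma>] I(2)[OF \<tau>] by (simp add: ennreal_mult)
  finally have "sint S ?\<rho> h + b = t * (sint S \<sigma> h + b) + (1 - t) * (sint S \<tau> h + b)"
    using t I(2)[OF \<sigma>] I(2)[OF \<tau>] I(2)[OF \<rho>] by (subst (asm) ennreal_inj) auto
  then show ?thesis by (simp add: algebra_simps)
qed

lemma measurable_projections_to_measure:
  shows "fst \<in> measurable (to_measure (X \<times> Y) \<pi>) (restrict_space borel X)"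
    and "snd \<in> measurable (to_measure (X \<times> Y) \<pi>) (restrict_space borel Y)"
  unfolding measurable_cong_sets[OF sets_to_measure refl]
  by (intro measurable_restrict_space2 measurable_restrict_space1
      borel_measurable_continuous_onI continuous_intros;
      auto simp: space_restrict_space)+

lemma measure_distr_projections:
  assumes "\<pi> \<in> prob_measures (X \<times> Y)"
  shows "A \<in> Bor X \<Longrightarrow> measure (distr (to_measure (X \<times> Y) \<pi>) (restrict_space borel X) fst) A = \<pi> (A \<times> Y)"
    and "B \<in> Bor Y \<Longrightarrow> measure (distr (to_measure (X \<times> Y) \<pi>) (restrict_space borel Y) snd) B = \<pi> (X \<times> B)"
proof -
  assume A: "A \<in> Bor X"
  then have "fst -` A \<inter> (X \<times> Y) = A \<times> Y" using Bor_subset_Pow[of X] by auto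
  then show "measure (distr (to_measure (X \<times> Y) \<pi>) (restrict_space borel X) fst) A = \<pi> (A \<times> Y)"
    using A measurable_projections_to_measure(1)[of X Y \<pi>]
    by (subst measure_distr) (auto simp: Bor_def measure_to_measure[OF assms])
next
  assume B: "B \<in> Bor Y"
  then have "snd -` B \<inter> (X \<times> Y) = X \<times> B" using Bor_subset_Pow[of Y] by auto
  then show "measure (distr (to_measure (X \<times> Y) \<pi>) (restrict_space borel Y) snd) B = \<pi> (X \<times> B)"
    using B measurable_projections_to_measure(2)[of X Y \<pi>]
    by (subst measure_distr) (auto simp: Bor_def measure_to_measure[OF assms])
qed

lemma measure_eq_iff_Bor:
  assumes "finite_measure M" "finite_measure N"
    "sets M = sets (restrict_space borel S)" "sets N = sets (restrict_space borel S)"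
  shows "M = N \<longleftrightarrow> (\<forall>A\<in>Bor S. measure M A = measure N A)"
proof -
  interpret M: finite_measure M by fact
  interpret N: finite_measure N by fact
  show ?thesis
    using assms(3,4)
    by (auto intro!: measure_eqI simp: Bor_def M.emeasure_eq_measure N.emeasure_eq_measure)
qed

text \<open>As an identity of measures, the marginal constraint can be tested by integrals and so
  passes to weak limits.\<close>

lemma Pi1_iff:
  assumes P: "prob_space P" "sets P = sets (restrict_space borel X)"
  shows "\<pi> \<in> Pi1 X Y P \<longleftrightarrow> \<pi> \<in> prob_measures (X \<times> Y) \<and>
    distr (to_measure (X \<times> Y) \<pi>) (restrict_space borel X) fst = P"
proof (cases "\<pi> \<in> prob_measures (X \<times> Y)")
  case True
  interpret prob_space "to_measure (X \<times> Y) \<pi>" by (rule prob_space_to_measure[OF True])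
  have "finite_measure (distr (to_measure (X \<times> Y) \<pi>) (restrict_space borel X) fst)"
    by (rule finite_measure_distr[OF measurable_projections_to_measure(1)])
  then have "distr (to_measure (X \<times> Y) \<pi>) (restrict_space borel X) fst = P \<longleftrightarrow>
      (\<forall>A\<in>Bor X. \<pi> (A \<times> Y) = measure P A)"
    using measure_eq_iff_Bor[of _ P X] P measure_distr_projections(1)[OF True]
      prob_space.finite_measure[OF P(1)]
    by auto
  then show ?thesis using True by (simp add: Pi1_def)
qed (simp add: Pi1_def)

lemma to_measure_marg2:
  assumes "\<pi> \<in> prob_measures (X \<times> Y)"
  shows "marg2 X Y \<pi> \<in> prob_measures Y"
    and "to_measure Y (marg2 X Y \<pi>) = distr (to_measure (X \<times> Y) \<pi>) (restrict_space borel Y) snd"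
proof -
  interpret prob_space "to_measure (X \<times> Y) \<pi>" by (rule prob_space_to_measure[OF assms])
  let ?N = "distr (to_measure (X \<times> Y) \<pi>) (restrict_space borel Y) snd"
  have N: "prob_space ?N" by (rule prob_space_distr[OF measurable_projections_to_measure(2)])
  have eq: "marg2 X Y \<pi> = measure ?N"
    using measure_distr_projections(2)[OF assms]
    by (auto simp: marg2_def fun_eq_iff Bor_def measure_notin_sets)
  show "marg2 X Y \<pi> \<in> prob_measures Y"
    unfolding eq by (rule measure_in_prob_measures[OF N]) simp
  show "to_measure Y (marg2 X Y \<pi>) = ?N"
    unfolding eq by (rule to_measure_measure[OF N]) simp
qed

lemma Pi2_iff:
  assumes Q: "prob_space Q" "sets Q = sets (restrict_space borel Y)"
  shows "\<pi> \<in> Pi2 X Y P Q \<longleftrightarrow> \<pi> \<in> Pi1 X Y P \<and> to_measure Y (marg2 X Y \<pi>) = Q"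
proof (cases "\<pi> \<in> Pi1 X Y P")
  case True
  then have \<pi>: "\<pi> \<in> prob_measures (X \<times> Y)" by (simp add: Pi1_def)
  have "finite_measure (to_measure Y (marg2 X Y \<pi>))"
    using prob_space_to_measure[OF to_measure_marg2(1)[OF \<pi>]] by (rule prob_space.finite_measure)
  then have "to_measure Y (marg2 X Y \<pi>) = Q \<longleftrightarrow> (\<forall>A\<in>Bor Y. \<pi> (X \<times> A) = measure Q A)"
    using measure_eq_iff_Bor[of _ Q Y] Q measure_to_measure[OF to_measure_marg2(1)[OF \<pi>]]
      prob_space.finite_measure[OF Q(1)]
    by (auto simp: sets_to_measure marg2_def)
  then show ?thesis using True by (simp add: Pi2_def)
qed (simp add: Pi2_def)

lemma sint_marg2:
  assumes "\<pi> \<in> prob_measures (X \<times> Y)" "continuous_on Y v"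
  shows "sint Y (marg2 X Y \<pi>) v = sint (X \<times> Y) \<pi> (\<lambda>z. v (snd z))"
  using integral_distr[OF measurable_projections_to_measure(2)
      borel_measurable_continuous_on_restrict[OF assms(2)], of X \<pi>]
  by (simp add: sint_prob assms(1) to_measure_marg2[OF assms(1)])

text \<open>The first marginal survives the limit because each \<open>V k\<close> composed with
  \<open>fst\<close> is a continuous test function whose integral is the same for all plans of the
  sequence.\<close>

lemma Pi1_sequentially_compact:
  fixes X :: "'a::euclidean_space set" and Y :: "'b::euclidean_space set"
  assumes X: "compact X" and Y: "compact Y"
    and P: "prob_space P" "sets P = sets (restrict_space borel X)"
    and \<sigma>: "\<And>n. \<sigma> n \<in> Pi1 X Y P"
  obtains r \<pi> where "strict_mono (r :: nat \<Rightarrow> nat)" "\<pi> \<in> Pi1 X Y P"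
    "\<And>h. continuous_on (X \<times> Y) h \<Longrightarrow> (\<lambda>n. sint (X \<times> Y) (\<sigma> (r n)) h) \<longlonglongrightarrow> sint (X \<times> Y) \<pi> h"
proof -
  have \<sigma>p: "\<sigma> n \<in> prob_measures (X \<times> Y)" for n using \<sigma> by (auto simp: Pi1_def)
  obtain r N where r: "strict_mono (r :: nat \<Rightarrow> nat)" and N: "prob_space N"
      "sets N = sets (restrict_space borel (X \<times> Y))"
    and lim: "\<And>h :: 'a \<times> 'b \<Rightarrow> real. continuous_on (X \<times> Y) h \<Longrightarrow>
      (\<lambda>n. \<integral>x. h x \<partial>to_measure (X \<times> Y) (\<sigma> (r n))) \<longlonglongrightarrow> (\<integral>x. h x \<partial>N)"
    by (rule prob_sequentially_compact[where M = "\<lambda>n. to_measure (X \<times> Y) (\<sigma> n)",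
          OF compact_Times[OF X Y] prob_space_to_measure[OF \<sigma>p] sets_to_measure]) blast
  have \<pi>: "measure N \<in> prob_measures (X \<times> Y)" by (rule measure_in_prob_measures[OF N])
  have tm: "to_measure (X \<times> Y) (measure N) = N" by (rule to_measure_measure[OF N])
  interpret N: prob_space N by (rule N)
  obtain V :: "nat \<Rightarrow> 'a \<Rightarrow> real" where V: "\<And>k. continuous_on UNIV (V k)"
    "\<And>S M N. finite_measure M \<Longrightarrow> finite_measure N \<Longrightarrow>
      sets M = sets (restrict_space borel S) \<Longrightarrow> sets N = sets (restrict_space borel S) \<Longrightarrow>
      (\<And>k. (\<integral>x. V k x \<partial>M) = (\<integral>x. V k x \<partial>N)) \<Longrightarrow> M = N"
    by (rule countable_measure_determining_continuous) blast
  note mf = measurable_projections_to_measure(1)[of X Y]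
  have VX: "V k \<in> borel_measurable (restrict_space borel X)" for k
    using V(1) by (intro borel_measurable_continuous_on_restrict) (rule continuous_on_subset, auto)
  have "distr N (restrict_space borel X) fst = P"
  proof (rule V(2)[of _ _ X])
    show "finite_measure (distr N (restrict_space borel X) fst)"
      using mf[of "measure N"] unfolding tm by (rule N.finite_measure_distr)
    show "finite_measure P" using P(1) by (rule prob_space.finite_measure)
    fix k
    have "(\<integral>z. V k (fst z) \<partial>to_measure (X \<times> Y) (\<sigma> n)) = (\<integral>x. V k x \<partial>P)" for n
      using \<sigma>[of n] integral_distr[OF mf VX, of "\<sigma> n" k] by (simp add: Pi1_iff[OF P])
    moreover have "continuous_on (X \<times> Y) (\<lambda>z. V k (fst z))"
      by (rule continuous_on_compose2[OF V(1)]) (auto intro!: continuous_intros)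
    ultimately have "(\<lambda>n. \<integral>x. V k x \<partial>P) \<longlonglongrightarrow> (\<integral>z. V k (fst z) \<partial>N)"
      using lim[of "\<lambda>z. V k (fst z)"] by simp
    then have "(\<integral>x. V k x \<partial>P) = (\<integral>z. V k (fst z) \<partial>N)" by (simp add: LIMSEQ_const_iff)
    then show "(\<integral>x. V k x \<partial>distr N (restrict_space borel X) fst) = (\<integral>x. V k x \<partial>P)"
      using integral_distr[OF mf VX, of "measure N" k] by (simp add: tm)
  qed (use P in auto)
  then have "measure N \<in> Pi1 X Y P" by (simp add: Pi1_iff[OF P] \<pi> tm)
  then show ?thesis
    using that[OF r, of "measure N"] lim by (simp add: sint_prob \<sigma>p \<pi> tm)
qed

section \<open>Duality\<close>

text \<open>Along plans with costs below \<open>- n\<close>, a weak-* limit would lie in every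
  sublevel set of \<open>F\<close> and have cost \<open>- \<infinity>\<close>. The bound obtained
  controls the penalties in \<open>finite_penalisation\<close>.\<close>

lemma lsc_bounded_below_on_Pi1:
  fixes X :: "'a::euclidean_space set" and Y :: "'b::euclidean_space set"
  assumes "compact X" "compact Y" "prob_space P" "sets P = sets (restrict_space borel X)"
    and proper: "\<forall>\<pi> \<in> fsm (X \<times> Y). F \<pi> \<noteq> - \<infinity>" and lsc: "wstar_lsc (X \<times> Y) F"
  obtains b :: real where "\<And>\<pi>. \<pi> \<in> Pi1 X Y P \<Longrightarrow> ereal b \<le> F \<pi>"
proof -
  have sub: "Pi1 X Y P \<subseteq> fsm (X \<times> Y)" by (auto simp: Pi1_def prob_measures_def)
  have "\<exists>b::real. \<forall>\<pi>\<in>Pi1 X Y P. ereal b \<le> F \<pi>"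
  proof (rule ccontr)
    assume "\<not> ?thesis"
    then have "\<forall>b::real. \<exists>\<pi>. \<pi> \<in> Pi1 X Y P \<and> F \<pi> < ereal b" by (auto simp: not_le)
    then have "\<forall>n::nat. \<exists>\<pi>. \<pi> \<in> Pi1 X Y P \<and> F \<pi> < ereal (- real n)" by blast
    from choice[OF this] obtain \<sigma> where \<sigma>: "\<And>n. \<sigma> n \<in> Pi1 X Y P"
        "\<And>n. F (\<sigma> n) < ereal (- real n)"
      by blast
    obtain r \<pi> where r: "strict_mono (r :: nat \<Rightarrow> nat)" "\<pi> \<in> Pi1 X Y P"
      "\<And>h. continuous_on (X \<times> Y) h \<Longrightarrow>
        (\<lambda>n. sint (X \<times> Y) (\<sigma> (r n)) h) \<longlonglongrightarrow> sint (X \<times> Y) \<pi> h"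
      by (rule Pi1_sequentially_compact[where \<sigma> = \<sigma>, OF assms(1-4) \<sigma>(1)]) blast
    have "F \<pi> \<le> ereal t" for t
    proof (rule wstar_lsc_sequentially[OF lsc _ _ r(3)])
      have "F (\<sigma> (r n)) \<le> ereal t" if "nat \<lceil>- t\<rceil> \<le> n" for n
      proof -
        have "- real (r n) \<le> t" using that seq_suble[OF r(1), of n] by linarith
        then have "ereal (- real (r n)) \<le> ereal t" by simp
        then show ?thesis by (rule order_trans[OF less_imp_le[OF \<sigma>(2)]])
      qed
      then show "\<forall>\<^sub>F n in sequentially. F (\<sigma> (r n)) \<le> ereal t"
        unfolding eventually_sequentially by blast
    qed (use r(2) \<sigma>(1) sub in auto)
    then have "F \<pi> = - \<infinity>" by (simp add: ereal_bot)
    then show False using proper r(2) sub by blast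
  qed
  then obtain b :: real where "\<forall>\<pi>\<in>Pi1 X Y P. ereal b \<le> F \<pi>" ..
  then show ?thesis by (intro that[of b]) blast
qed

text \<open>Scaling the first n members of a measure-determining sequence by plus and minus n suffices for
  large n: a weak-* limit of violating plans would have second marginal Q and cost at most t.\<close>
lemma finite_penalisation:
  fixes X :: "'a::euclidean_space set" and Y :: "'b::euclidean_space set"
  assumes X: "compact X" and Y: "compact Y"
    and P: "prob_space P" "sets P = sets (restrict_space borel X)"
    and Q: "prob_space Q" "sets Q = sets (restrict_space borel Y)"
    and proper: "\<forall>\<pi> \<in> fsm (X \<times> Y). F \<pi> \<noteq> - \<infinity>" and lsc: "wstar_lsc (X \<times> Y) F"
    and t: "ereal t < Cost X Y F P Q"
  obtains I where "finite I" "I \<noteq> {}" "I \<subseteq> Cf Y"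
    "\<And>\<pi>. \<pi> \<in> Pi1 X Y P \<Longrightarrow> \<exists>v\<in>I. ereal t \<le> Lag X Y F Q v \<pi>"
proof -
  obtain b :: real where b: "\<And>\<pi>. \<pi> \<in> Pi1 X Y P \<Longrightarrow> ereal b \<le> F \<pi>"
    using lsc_bounded_below_on_Pi1[OF X Y P proper lsc] by blast
  obtain V :: "nat \<Rightarrow> 'b \<Rightarrow> real" where V: "\<And>k. continuous_on UNIV (V k)"
    "\<And>S M N. finite_measure M \<Longrightarrow> finite_measure N \<Longrightarrow>
      sets M = sets (restrict_space borel S) \<Longrightarrow> sets N = sets (restrict_space borel S) \<Longrightarrow>
      (\<And>k. (\<integral>x. V k x \<partial>M) = (\<integral>x. V k x \<partial>N)) \<Longrightarrow> M = N"
    by (rule countable_measure_determining_continuous) blast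
  have VY: "continuous_on Y (V k)" for k using V(1) by (rule continuous_on_subset) simp
  define I where "I n = (\<lambda>(k, s) y. s * real n * V k y) ` ({..n} \<times> {1, -1})" for n :: nat
  have I: "finite (I n)" "I n \<noteq> {}" "I n \<subseteq> Cf Y" for n
    by (auto simp: I_def Cf_def intro!: continuous_intros VY)
  have "\<exists>n. \<forall>\<pi>\<in>Pi1 X Y P. \<exists>v\<in>I n. ereal t \<le> Lag X Y F Q v \<pi>"
  proof (rule ccontr)
    assume "\<not> ?thesis"
    then have "\<forall>n. \<exists>\<pi>. \<pi> \<in> Pi1 X Y P \<and> (\<forall>v\<in>I n. Lag X Y F Q v \<pi> < ereal t)"
      by (auto simp: not_le)
    from choice[OF this] obtain \<sigma> where \<sigma>: "\<And>n. \<sigma> n \<in> Pi1 X Y P"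
        "\<And>n v. v \<in> I n \<Longrightarrow> Lag X Y F Q v (\<sigma> n) < ereal t"
      by blast
    obtain r \<pi> where r: "strict_mono (r :: nat \<Rightarrow> nat)" "\<pi> \<in> Pi1 X Y P"
      "\<And>h. continuous_on (X \<times> Y) h \<Longrightarrow>
        (\<lambda>n. sint (X \<times> Y) (\<sigma> (r n)) h) \<longlonglongrightarrow> sint (X \<times> Y) \<pi> h"
      by (rule Pi1_sequentially_compact[where \<sigma> = \<sigma>, OF X Y P \<sigma>(1)]) blast
    have prob: "\<sigma> n \<in> prob_measures (X \<times> Y)" "\<pi> \<in> prob_measures (X \<times> Y)" for n
      using \<sigma>(1) r(2) by (auto simp: Pi1_def)
    define e where "e n k = sint Y (marg2 X Y (\<sigma> n)) (V k) - (\<integral>y. V k y \<partial>Q)" for n k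
    \<comment> \<open>Averaging the inequalities for the two signs removes the penalty and gives the
      bound on \<open>F\<close>; each of them combined with \<open>b \<le> F (\<sigma> n)\<close>
      bounds one sign of the defect.\<close>
    have bnd: "F (\<sigma> n) \<le> ereal t \<and> real n * \<bar>e n k\<bar> \<le> t - b" if k: "k \<le> n" for n k
    proof -
      have lin: "sint Y (marg2 X Y (\<sigma> n)) (\<lambda>y. s * real n * V k y)
          = s * real n * sint Y (marg2 X Y (\<sigma> n)) (V k)" for s
        by (simp add: sint_prob to_measure_marg2(1)[OF prob(1)])
      have L: "F (\<sigma> n) - ereal (s * real n * sint Y (marg2 X Y (\<sigma> n)) (V k))
          + ereal (s * real n * (\<integral>y. V k y \<partial>Q)) < ereal t" if "s \<in> {1, -1}" for s
      proof -
        have "(\<lambda>y. s * real n * V k y) \<in> I n"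
          unfolding I_def using that k by (intro image_eqI[of _ _ "(k, s)"]) auto
        from \<sigma>(2)[OF this] show ?thesis by (simp add: Lag_def lin)
      qed
      obtain f where f: "F (\<sigma> n) = ereal f"
        using L[of 1] b[OF \<sigma>(1)[of n]] by (cases "F (\<sigma> n)") auto
      have "b \<le> f" using b[OF \<sigma>(1)[of n]] f by simp
      moreover have "f - real n * e n k < t" "f + real n * e n k < t"
        using L[of 1] L[of "-1"] by (simp_all add: f e_def algebra_simps)
      ultimately show ?thesis
        unfolding f by (auto simp: abs_if mult_minus_right)
    qed
    have "F \<pi> \<le> ereal t"
      by (rule wstar_lsc_sequentially[OF lsc _ _ r(3)])
         (use bnd[OF le0] prob in \<open>auto simp: prob_measures_def\<close>)
    moreover have "\<pi> \<in> Pi2 X Y P Q"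
      unfolding Pi2_iff[OF Q]
    proof (intro conjI r(2) V(2)[of _ _ Y])
      show "finite_measure (to_measure Y (marg2 X Y \<pi>))" "finite_measure Q"
        using prob_space_to_measure[OF to_measure_marg2(1)[OF prob(2)]] Q(1)
        by (auto intro: prob_space.finite_measure)
      fix k
      have cont: "continuous_on (X \<times> Y) (\<lambda>z. V k (snd z))"
        by (rule continuous_on_compose2[OF V(1)]) (auto intro!: continuous_intros)
      have "(\<lambda>n. e (r n) k) \<longlonglongrightarrow> sint Y (marg2 X Y \<pi>) (V k) - (\<integral>y. V k y \<partial>Q)"
        unfolding e_def using r(3)[OF cont] by (intro tendsto_intros) (simp add: sint_marg2 prob VY)
      moreover have "(\<lambda>n. e (r n) k) \<longlonglongrightarrow> 0"
      proof (rule Lim_null_comparison)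
        \<comment> \<open>From \<open>Suc k\<close> on, division by \<open>n\<close> is legitimate
          and \<open>k \<le> n \<le> r n\<close>, so the potentials for \<open>V k\<close> belong to
          the family violated by \<open>\<sigma> (r n)\<close>.\<close>
        show "\<forall>\<^sub>F n in sequentially. norm (e (r n) k) \<le> (t - b) * (1 / real n)"
          unfolding eventually_sequentially
        proof (intro exI[of _ "Suc k"] allI impI)
          fix n assume n: "Suc k \<le> n"
          have le: "n \<le> r n" by (rule seq_suble[OF r(1)])
          have "real n * \<bar>e (r n) k\<bar> \<le> real (r n) * \<bar>e (r n) k\<bar>"
            using le by (intro mult_right_mono) auto
          also have "\<dots> \<le> t - b" using bnd[of k "r n"] n le by simp
          finally show "norm (e (r n) k) \<le> (t - b) * (1 / real n)"
            using n by (simp add: field_simps)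
        qed
        show "(\<lambda>n. (t - b) * (1 / real n)) \<longlonglongrightarrow> 0"
          by (rule tendsto_mult_right_zero[OF lim_1_over_n])
      qed
      ultimately have "sint Y (marg2 X Y \<pi>) (V k) - (\<integral>y. V k y \<partial>Q) = 0"
        by (rule LIMSEQ_unique)
      then show "(\<integral>y. V k y \<partial>to_measure Y (marg2 X Y \<pi>)) = (\<integral>y. V k y \<partial>Q)"
        by (simp add: sint_prob to_measure_marg2(1)[OF prob(2)])
    qed (use Q(2) in \<open>auto simp: sets_to_measure\<close>)
    ultimately have "Cost X Y F P Q \<le> ereal t"
      unfolding Cost_def by (rule INF_lower2[rotated])
    then show False using t by simp
  qed
  then obtain n where "\<forall>\<pi>\<in>Pi1 X Y P. \<exists>v\<in>I n. ereal t \<le> Lag X Y F Q v \<pi>" ..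
  then show ?thesis by (intro that[OF I[of n]]) blast
qed

theorem theorem1:
  fixes X Y :: "'a::euclidean_space set" and P Q :: "'a measure"
    and F :: "(('a \<times> 'a) set \<Rightarrow> real) \<Rightarrow> ereal"
  assumes "compact X" and "Y = X"
    and "prob_space P" and "sets P = sets (restrict_space borel X)"
    and "prob_space Q" and "sets Q = sets (restrict_space borel Y)"
    and "\<forall>\<pi> \<in> fsm (X \<times> Y). F \<pi> \<noteq> - \<infinity>"
    and "convex_M (X \<times> Y) F" and "wstar_lsc (X \<times> Y) F" and "sep_star_incr X Y F"
    and "\<exists>\<pi> \<in> Pi2 X Y P Q. F \<pi> < \<infinity>"
  shows "Cost X Y F P Q = (SUP v \<in> Cf Y. INF \<pi> \<in> Pi1 X Y P. Lag X Y F Q v \<pi>)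
    \<and> Cost X Y F P Q = (SUP v \<in> Cf Y. INF \<pi> \<in> Pi1 X Y P.
         (F \<pi> - ereal (sint Y (marg2 X Y \<pi>) v)) + ereal (\<integral>y. v y \<partial>Q))"
proof -
  have X: "compact X" and Y: "compact Y" using assms(1,2) by auto
  note P = assms(3,4) and Q = assms(5,6) and proper = assms(7) and cvx = assms(8) and lsc = assms(9)
  have prob: "\<pi> \<in> prob_measures (X \<times> Y)" if "\<pi> \<in> Pi1 X Y P" for \<pi> using that by (simp add: Pi1_def)
  have fsm: "\<pi> \<in> fsm (X \<times> Y)" if "\<pi> \<in> Pi1 X Y P" for \<pi>
    using prob[OF that] by (simp add: prob_measures_def)
  let ?J = "\<lambda>\<pi>. sint Y (marg2 X Y \<pi>)"
  have "(SUP v \<in> Cf Y. INF \<pi> \<in> Pi1 X Y P. Lag X Y F Q v \<pi>) \<le> Cost X Y F P Q"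
    unfolding Cost_def
  proof (intro SUP_least INF_greatest)
    fix v \<pi> assume \<pi>: "\<pi> \<in> Pi2 X Y P Q"
    then have \<pi>1: "\<pi> \<in> Pi1 X Y P" and tm: "to_measure Y (marg2 X Y \<pi>) = Q"
      by (auto simp: Pi2_iff[OF Q])
    \<comment> \<open>The two integrals of \<open>v\<close> coincide; the case split covers
      cancellation of a finite term when \<open>F \<pi>\<close> is infinite.\<close>
    have "Lag X Y F Q v \<pi> = F \<pi>"
      unfolding Lag_def sint_prob[OF to_measure_marg2(1)[OF prob[OF \<pi>1]]] tm
      by (cases "F \<pi>") auto
    then show "(INF \<pi> \<in> Pi1 X Y P. Lag X Y F Q v \<pi>) \<le> F \<pi>"
      using INF_lower[OF \<pi>1, of "Lag X Y F Q v"] by simp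
  qed
  moreover have "Cost X Y F P Q \<le> (SUP v \<in> Cf Y. INF \<pi> \<in> Pi1 X Y P. Lag X Y F Q v \<pi>)"
  proof (rule ccontr)
    assume "\<not> ?thesis"
    then obtain t where t: "(SUP v \<in> Cf Y. INF \<pi> \<in> Pi1 X Y P. Lag X Y F Q v \<pi>) < ereal t"
        "ereal t < Cost X Y F P Q"
      using ereal_dense2[of _ "Cost X Y F P Q"] by (auto simp: not_le)
    obtain I where I: "finite I" "I \<noteq> {}" "I \<subseteq> Cf Y"
        "\<And>\<pi>. \<pi> \<in> Pi1 X Y P \<Longrightarrow> \<exists>v\<in>I. ereal t \<le> Lag X Y F Q v \<pi>"
      using finite_penalisation[OF X Y P Q proper lsc t(2)] by blast
    \<comment> \<open>The minimax lemma needs real values. On \<open>A\<close> the cost is finite,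
      and convexity of \<open>F\<close> keeps mixtures in \<open>A\<close>.\<close>
    define A where "A = {\<pi> \<in> Pi1 X Y P. F \<pi> \<noteq> \<infinity>}"
    define f where "f v \<pi> = real_of_ereal (F \<pi>) - ?J \<pi> v + (\<integral>y. v y \<partial>Q)" for v \<pi>
    have F_real: "F \<pi> = ereal (real_of_ereal (F \<pi>))" if "\<pi> \<in> A" for \<pi>
      using that proper fsm[of \<pi>] by (cases "F \<pi>") (auto simp: A_def)
    have Lag_f: "Lag X Y F Q v \<pi> = ereal (f v \<pi>)" if "\<pi> \<in> A" for v \<pi>
      unfolding Lag_def f_def by (subst F_real[OF that]) simp
    have "\<exists>w. (\<forall>v\<in>I. 0 \<le> w v) \<and> sum w I = 1 \<and> (\<forall>\<pi>\<in>A. t \<le> (\<Sum>v\<in>I. w v * f v \<pi>))"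
    proof (rule finite_minimax[OF I(1,2)])
      fix \<sigma> \<tau> and s :: real
      assume *: "\<sigma> \<in> A" "\<tau> \<in> A" "0 \<le> s" "s \<le> 1"
      then have **: "\<sigma> \<in> Pi1 X Y P" "\<tau> \<in> Pi1 X Y P" by (auto simp: A_def)
      let ?\<rho> = "\<lambda>B. s * \<sigma> B + (1 - s) * \<tau> B"
      have \<rho>: "?\<rho> \<in> Pi1 X Y P"
        using ** prob_measures_mixture[OF prob[OF **(1)] prob[OF **(2)] *(3,4)]
        by (auto simp: Pi1_def algebra_simps)
      have "F ?\<rho> \<le> ereal s * F \<sigma> + ereal (1 - s) * F \<tau>"
        using cvx fsm[OF **(1)] fsm[OF **(2)] *(3,4) unfolding convex_M_def by blast
      also have "\<dots> = ereal (s * real_of_ereal (F \<sigma>) + (1 - s) * real_of_ereal (F \<tau>))"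
        by (subst F_real[OF *(1)], subst F_real[OF *(2)]) simp
      finally have F\<rho>: "F ?\<rho> \<le> ereal (s * real_of_ereal (F \<sigma>) + (1 - s) * real_of_ereal (F \<tau>))" .
      then have \<rho>A: "?\<rho> \<in> A" using \<rho> by (auto simp: A_def)
      have F\<rho>': "real_of_ereal (F ?\<rho>) \<le> s * real_of_ereal (F \<sigma>) + (1 - s) * real_of_ereal (F \<tau>)"
        using F\<rho> by (subst (asm) F_real[OF \<rho>A]) simp
      have "f v ?\<rho> \<le> s * f v \<sigma> + (1 - s) * f v \<tau>" if v: "v \<in> I" for v
      proof -
        have "marg2 X Y ?\<rho> = (\<lambda>B. s * marg2 X Y \<sigma> B + (1 - s) * marg2 X Y \<tau> B)"
          by (auto simp: marg2_def)
        moreover have "continuous_on Y v" using I(3) v by (auto simp: Cf_def)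
        ultimately have "?J ?\<rho> v = s * ?J \<sigma> v + (1 - s) * ?J \<tau> v"
          using sint_mixture[OF Y _ to_measure_marg2(1)[OF prob[OF **(1)]]
              to_measure_marg2(1)[OF prob[OF **(2)]] *(3,4)] by simp
        then show ?thesis using F\<rho>' by (simp add: f_def algebra_simps)
      qed
      then show "\<exists>c\<in>A. \<forall>v\<in>I. f v c \<le> s * f v \<sigma> + (1 - s) * f v \<tau>" using \<rho>A by blast
    next
      fix \<pi> assume \<pi>: "\<pi> \<in> A"
      then show "\<exists>v\<in>I. t \<le> f v \<pi>" using I(4)[of \<pi>] by (auto simp: Lag_f) (auto simp: A_def)
    qed
    then obtain w where w: "\<And>v. v \<in> I \<Longrightarrow> 0 \<le> w v" "sum w I = 1"
        "\<And>\<pi>. \<pi> \<in> A \<Longrightarrow> t \<le> (\<Sum>v\<in>I. w v * f v \<pi>)"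
      by blast
    \<comment> \<open>The Lagrangian is affine in the potential, so with weights of sum 1 the
      weighted average of the Lagrangians is the Lagrangian of this single continuous
      potential.\<close>
    define v where "v y = (\<Sum>u\<in>I. w u * u y)" for y
    have "v \<in> Cf Y"
      unfolding v_def Cf_def using I(3) by (auto simp: Cf_def intro!: continuous_intros)
    have int: "(\<integral>y. v y \<partial>to_measure Y \<nu>) = (\<Sum>u\<in>I. w u * (\<integral>y. u y \<partial>to_measure Y \<nu>))"
      if "\<nu> \<in> prob_measures Y" for \<nu>
    proof -
      have "integrable (to_measure Y \<nu>) u" if "u \<in> I" for u
        using integrable_to_measure[OF Y \<open>\<nu> \<in> prob_measures Y\<close>] I(3) that by (auto simp: Cf_def)
      then show ?thesis unfolding v_def by (simp add: Bochner_Integration.integral_sum)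
    qed
    have intQ: "(\<integral>y. v y \<partial>Q) = (\<Sum>u\<in>I. w u * (\<integral>y. u y \<partial>Q))"
      using int[OF measure_in_prob_measures[OF Q]] by (simp add: to_measure_measure[OF Q])
    have "ereal t \<le> Lag X Y F Q v \<pi>" if \<pi>: "\<pi> \<in> Pi1 X Y P" for \<pi>
    proof (cases "\<pi> \<in> A")
      case True
      have m: "marg2 X Y \<pi> \<in> prob_measures Y" by (rule to_measure_marg2(1)[OF prob[OF \<pi>]])
      have "(\<Sum>u\<in>I. w u * f u \<pi>)
          = sum w I * real_of_ereal (F \<pi>) - (\<Sum>u\<in>I. w u * ?J \<pi> u) + (\<Sum>u\<in>I. w u * (\<integral>y. u y \<partial>Q))"
        unfolding f_def sum_distrib_right
        by (simp add: algebra_simps sum.distrib sum_subtractf)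
      also have "\<dots> = f v \<pi>"
        by (simp add: f_def w(2) sint_prob[OF m] int[OF m] intQ)
      finally show ?thesis using w(3)[OF True] by (simp add: Lag_f[OF True])
    next
      case False
      then have "F \<pi> = \<infinity>" using \<pi> by (simp add: A_def)
      then show ?thesis by (simp add: Lag_def)
    qed
    then have "ereal t \<le> (SUP v \<in> Cf Y. INF \<pi> \<in> Pi1 X Y P. Lag X Y F Q v \<pi>)"
      using \<open>v \<in> Cf Y\<close> by (intro SUP_upper2[of v] INF_greatest) auto
    then show False using t(1) by simp
  qed
  ultimately have "Cost X Y F P Q = (SUP v \<in> Cf Y. INF \<pi> \<in> Pi1 X Y P. Lag X Y F Q v \<pi>)"
    by (rule antisym[rotated])
  then show ?thesis by (simp add: Lag_def)
qed

end
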